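(* Let $H=(V,E)$ be a finite graph, $p\in(0,1)$, $q>0$, $\mu=\mu_{p,q}$ on $\Omega_E=\{A:A\subseteq E\}$, $r\in\mathbb N$, $\Omega_V=\{0,\dots,r-1\}^V$, $\Omega_J=\Omega_V\times\Omega_E$. Let $P$ be the transition matrix of an ergodic Markov chain on $\Omega_E$ reversible w.r.t. $\mu$, and suppose $P=M\left(\prod_{i=1}^m T_i\right)M^*$, where: (i) $M$ is a stochastic $|\Omega_E|\times|\Omega_J|$ matrix with $M(A,(\sigma,B))\neq0$ only if $A=B$; (ii) with $\nu=\mu M$, each $T_i$ is a stochastic $|\Omega_J|\times|\Omega_J|$ matrix reversible w.r.t. $\nu$ with $T_i((\sigma,A),(\tau,B))\ne0$ only if $\sigma=\tau$; (iii) $M^*$ is the adjoint of $M:L_2(\nu)\to L_2(\mu)$ (and is stochastic). Suppose moreover that the $T_i$ are idempotent and pairwise commuting as operators on $L_2(\nu)$. Let $P_L=M\left(\frac1m\sum_{i=1}^m T_i\right)M^*$. Then $$\lambda(P_L)\le\lambda(P)\le 8m\log m\cdot\lambda(P_L).$$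
   Context: $\mu_{p,q}(A)\propto p^{|A|}(1-p)^{|E|-|A|}q^{c(A)}$, $c(A)$ the number of connected components of $(V,A)$. $L_2(\pi)$ denotes $\mathbb R^{\Omega}$ with inner product $\langle f,g\rangle_\pi=\sum_x f(x)g(x)\pi(x)$; a matrix acts on functions by matrix–vector multiplication. The adjoint $R^*$ of $R:S_2\to S_1$ satisfies $\langle f,Rg\rangle_{S_1}=\langle R^*f,g\rangle_{S_2}$; concretely $M^*((\sigma,A),B)=\mu(B)M(B,(\sigma,A))/\nu(\sigma,A)$. For a reversible transition matrix $Q$ with eigenvalues $1=\lambda_1\ge\lambda_2\ge\dots\ge\lambda_N$, the spectral gap is $\lambda(Q)=1-\max\{|\lambda_2|,|\lambda_N|\}$. *)

theory Defs
  imports Complex_Main "HOL-Library.FuncSet" "Jordan_Normal_Form.Char_Poly"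
begin

section \<open>Simple finite graphs and the random-cluster measure\<close>

definition finite_graph :: "'v set \<Rightarrow> 'v set set \<Rightarrow> bool" where
  "finite_graph V E \<longleftrightarrow> finite V \<and>
     (\<forall>e\<in>E. \<exists>u w. u \<in> V \<and> w \<in> V \<and> u \<noteq> w \<and> e = {u, w})"

text \<open>Connectivity relation of the spanning subgraph (V,A) and number of components c(A).\<close>
definition conn_rel :: "'v set \<Rightarrow> 'v set set \<Rightarrow> ('v \<times> 'v) set" where
  "conn_rel V A = ({(u, w). {u, w} \<in> A}\<^sup>* ) \<inter> (V \<times> V)"

definition num_components :: "'v set \<Rightarrow> 'v set set \<Rightarrow> nat" where
  "num_components V A = card (V // conn_rel V A)"

definition rc_weight :: "'v set \<Rightarrow> 'v set set \<Rightarrow> real \<Rightarrow> real \<Rightarrow> 'v set set \<Rightarrow> real" where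
  "rc_weight V E p q A = p ^ card A * (1 - p) ^ (card E - card A) * q ^ num_components V A"

definition rc_measure :: "'v set \<Rightarrow> 'v set set \<Rightarrow> real \<Rightarrow> real \<Rightarrow> 'v set set \<Rightarrow> real" where
  "rc_measure V E p q A =
     rc_weight V E p q A / (\<Sum>B\<in>Pow E. rc_weight V E p q B)"

section \<open>Matrices indexed by finite state spaces (as functions)\<close>

definition stochastic :: "'a set \<Rightarrow> 'b set \<Rightarrow> ('a \<Rightarrow> 'b \<Rightarrow> real) \<Rightarrow> bool" where
  "stochastic S1 S2 X \<longleftrightarrow>
     (\<forall>x\<in>S1. (\<forall>y\<in>S2. X x y \<ge> 0) \<and> (\<Sum>y\<in>S2. X x y) = 1)"

definition mmult :: "'b set \<Rightarrow> ('a \<Rightarrow> 'b \<Rightarrow> real) \<Rightarrow> ('b \<Rightarrow> 'c \<Rightarrow> real) \<Rightarrow> 'a \<Rightarrow> 'c \<Rightarrow> real" where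
  "mmult S X Y = (\<lambda>a c. \<Sum>b\<in>S. X a b * Y b c)"

definition mid :: "'a \<Rightarrow> 'a \<Rightarrow> real" where
  "mid = (\<lambda>a b. if a = b then 1 else 0)"

text \<open>Ordered product X1 X2 ... Xk of square matrices on S.\<close>
definition mprod_list :: "'a set \<Rightarrow> ('a \<Rightarrow> 'a \<Rightarrow> real) list \<Rightarrow> 'a \<Rightarrow> 'a \<Rightarrow> real" where
  "mprod_list S Xs = foldr (mmult S) Xs mid"

definition mpow :: "'a set \<Rightarrow> ('a \<Rightarrow> 'a \<Rightarrow> real) \<Rightarrow> nat \<Rightarrow> 'a \<Rightarrow> 'a \<Rightarrow> real" where
  "mpow S X n = mprod_list S (replicate n X)"

definition reversible :: "'a set \<Rightarrow> ('a \<Rightarrow> real) \<Rightarrow> ('a \<Rightarrow> 'a \<Rightarrow> real) \<Rightarrow> bool" where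
  "reversible S w Q \<longleftrightarrow> (\<forall>x\<in>S. \<forall>y\<in>S. w x * Q x y = w y * Q y x)"

definition irreducible_chain :: "'a set \<Rightarrow> ('a \<Rightarrow> 'a \<Rightarrow> real) \<Rightarrow> bool" where
  "irreducible_chain S Q \<longleftrightarrow> (\<forall>x\<in>S. \<forall>y\<in>S. \<exists>n. mpow S Q n x y > 0)"

definition aperiodic_chain :: "'a set \<Rightarrow> ('a \<Rightarrow> 'a \<Rightarrow> real) \<Rightarrow> bool" where
  "aperiodic_chain S Q \<longleftrightarrow> (\<forall>x\<in>S. Gcd {n. n \<ge> 1 \<and> mpow S Q n x x > 0} = (1::nat))"

definition ergodic_chain :: "'a set \<Rightarrow> ('a \<Rightarrow> 'a \<Rightarrow> real) \<Rightarrow> bool" where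
  "ergodic_chain S Q \<longleftrightarrow> stochastic S S Q \<and> irreducible_chain S Q \<and> aperiodic_chain S Q"

text \<open>nu = mu M, and the adjoint M* of M : L2(nu) -> L2(mu):
  M*(x,B) = mu(B) M(B,x) / nu(x).\<close>
definition push_measure :: "'a set \<Rightarrow> ('a \<Rightarrow> real) \<Rightarrow> ('a \<Rightarrow> 'b \<Rightarrow> real) \<Rightarrow> 'b \<Rightarrow> real" where
  "push_measure S mu M = (\<lambda>x. \<Sum>A\<in>S. mu A * M A x)"

definition adjoint :: "'a set \<Rightarrow> ('a \<Rightarrow> real) \<Rightarrow> ('a \<Rightarrow> 'b \<Rightarrow> real) \<Rightarrow> 'b \<Rightarrow> 'a \<Rightarrow> real" where
  "adjoint S mu M = (\<lambda>x B. mu B * M B x / push_measure S mu M x)"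

section \<open>Spectral gap\<close>

text \<open>A fixed enumeration of a finite state space, and the matrix in JNF form.\<close>
definition enum_list :: "'a set \<Rightarrow> 'a list" where
  "enum_list S = (SOME xs. distinct xs \<and> set xs = S)"

definition to_mat :: "'a set \<Rightarrow> ('a \<Rightarrow> 'a \<Rightarrow> real) \<Rightarrow> real mat" where
  "to_mat S Q = (let xs = enum_list S in
     mat (length xs) (length xs) (\<lambda>(i, j). Q (xs ! i) (xs ! j)))"

text \<open>Eigenvalues with multiplicity, in non-increasing order
  (lambda_1 >= lambda_2 >= ... >= lambda_N); meaningful for reversible Q,
  whose characteristic polynomial splits over the reals.\<close>
definition eigenvalues_desc :: "'a set \<Rightarrow> ('a \<Rightarrow> 'a \<Rightarrow> real) \<Rightarrow> real list" where
  "eigenvalues_desc S Q = (THE ls. sorted_wrt (\<ge>) ls \<and>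
      char_poly (to_mat S Q) = (\<Prod>l\<leftarrow>ls. [:- l, 1:]))"

text \<open>lambda(Q) = 1 - max(|lambda_2|, |lambda_N|); for a one-point space (no lambda_2)
  we use the convention lambda(Q) = 1.\<close>
definition spectral_gap :: "'a set \<Rightarrow> ('a \<Rightarrow> 'a \<Rightarrow> real) \<Rightarrow> real" where
  "spectral_gap S Q = (let ls = eigenvalues_desc S Q; N = length ls in
     if N \<ge> 2 then 1 - max \<bar>ls ! 1\<bar> \<bar>ls ! (N - 1)\<bar> else 1)"

end

(*
  On L2(nu) the T i are commuting orthogonal projections, so their product Pi projects onto the
  intersection of their ranges. For g = M* f this gives <Pi g, g> <= <T i g, g> for every i and,
  splitting off one projection at a time, ||g||^2 - <Pi g, g> <= sum_i (||g||^2 - <T i g, g>).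
  Since M* is adjoint to M and a contraction from L2(mu) to L2(nu), the quadratic forms of
  P = M Pi M* and P_L = M (1/m sum_i T i) M* satisfy
    <f, P f> <= <f, P_L f> <= (1/m) <f, P f> + (1 - 1/m) ||f||^2.
  By the Courant-Fischer principle, applied to the symmetric matrices D^(1/2) Q D^(-1/2) similar
  to the reversible chains Q, these inequalities pass to every sorted eigenvalue. Both chains are
  positive semidefinite, so their spectral gaps are 1 - lambda_2, whence
  lambda(P_L) <= lambda(P) <= m lambda(P_L) <= 8 m log m lambda(P_L).
*)

theory Submission
  imports Defs "Jordan_Normal_Form.Schur_Decomposition"
begin

section \<open>Spectral theorem for real symmetric matrices\<close>

definition orthonormal :: "nat \<Rightarrow> real vec list \<Rightarrow> bool" where
  "orthonormal n ws \<longleftrightarrow> set ws \<subseteq> carrier_vec n \<and>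
     (\<forall>i<length ws. \<forall>j<length ws. ws ! i \<bullet> ws ! j = (if i = j then 1 else 0))"

lemma orthonormal_normalize:
  fixes ws :: "real vec list"
  assumes ws: "set ws \<subseteq> carrier_vec n" and orth: "corthogonal ws"
  shows "orthonormal n (map (\<lambda>w. (1 / sqrt (w \<bullet> w)) \<cdot>\<^sub>v w) ws)"
proof -
  have carr: "\<And>i. i < length ws \<Longrightarrow> ws ! i \<in> carrier_vec n" using ws by auto
  have orth0: "\<And>i j. i < length ws \<Longrightarrow> j < length ws \<Longrightarrow> ws ! i \<bullet> ws ! j = 0 \<longleftrightarrow> i \<noteq> j"
    using orth unfolding corthogonal_def by simp
  have pos: "ws ! i \<bullet> ws ! i > 0" if i: "i < length ws" for i
    using conjugate_square_ge_0_vec[of "ws ! i"] orth0[OF i i] by auto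
  have "(1 / sqrt (ws ! i \<bullet> ws ! i) \<cdot>\<^sub>v ws ! i) \<bullet> (1 / sqrt (ws ! j \<bullet> ws ! j) \<cdot>\<^sub>v ws ! j)
      = (if i = j then 1 else 0)" if i: "i < length ws" and j: "j < length ws" for i j
  proof -
    have "(1 / sqrt (ws ! i \<bullet> ws ! i) \<cdot>\<^sub>v ws ! i) \<bullet> (1 / sqrt (ws ! j \<bullet> ws ! j) \<cdot>\<^sub>v ws ! j)
        = ws ! i \<bullet> ws ! j / (sqrt (ws ! i \<bullet> ws ! i) * sqrt (ws ! j \<bullet> ws ! j))"
      using carr[OF i] carr[OF j] by (simp add: smult_scalar_prod_distrib scalar_prod_smult_distrib)
    then show ?thesis using pos[OF i] orth0[OF i j] by (cases "i = j") simp_all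
  qed
  then show ?thesis
    using carr unfolding orthonormal_def by (auto simp: in_set_conv_nth)
qed

lemma orthonormal_basis_extension:
  fixes v :: "real vec"
  assumes v: "v \<in> carrier_vec n" and v1: "v \<bullet> v = 1"
  shows "\<exists>ws. length ws = n \<and> orthonormal n ws \<and> ws ! 0 = v"
proof -
  interpret cof_vec_space n "TYPE(real)" .
  have v0: "v \<noteq> 0\<^sub>v n" using v1 by auto
  define b where "b = basis_completion v"
  note bc = basis_completion[OF v v0, folded b_def]
  define gs where "gs = gram_schmidt n b"
  note gsr = gram_schmidt_result[OF bc(2) bc(4) bc(5) gs_def]
  have len: "length gs = n" using gsr bc by simp
  have "n > 0" using v v1 by (cases n) (auto simp: scalar_prod_def)
  moreover from this bc(6) bc(7) obtain vs where "b = v # vs" by (cases b) auto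
  ultimately have "gs ! 0 = v" using gram_schmidt_hd[OF v, of vs] gs_def len
    by (metis hd_conv_nth length_greater_0_conv)
  then show ?thesis
    using orthonormal_normalize[OF gsr(3,2)] len v1 \<open>n > 0\<close>
    by (intro exI[of _ "map (\<lambda>w. (1 / sqrt (w \<bullet> w)) \<cdot>\<^sub>v w) gs"]) simp
qed

lemma orthonormal_mat_of_cols:
  assumes on: "orthonormal n ws" and len: "length ws = n"
  defines "W \<equiv> mat_of_cols n ws"
  shows "W \<in> carrier_mat n n" "transpose_mat W * W = 1\<^sub>m n" "W * transpose_mat W = 1\<^sub>m n"
proof -
  show W: "W \<in> carrier_mat n n" unfolding W_def using len by auto
  have c: "\<And>i. i < n \<Longrightarrow> col W i = ws ! i" unfolding W_def
    using on len by (intro col_mat_of_cols) (auto simp: orthonormal_def)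
  show WW: "transpose_mat W * W = 1\<^sub>m n"
    using W on len c by (intro eq_matI) (auto simp: orthonormal_def)
  show "W * transpose_mat W = 1\<^sub>m n" using mat_mult_left_right_inverse[OF _ W WW] W by auto
qed

lemma orthogonal_mat_scalar_prod:
  fixes W :: "real mat"
  assumes W: "W \<in> carrier_mat n n" and WW: "transpose_mat W * W = 1\<^sub>m n"
    and x: "x \<in> carrier_vec n" and y: "y \<in> carrier_vec n"
  shows "(W *\<^sub>v x) \<bullet> (W *\<^sub>v y) = x \<bullet> y"
proof -
  have "(W *\<^sub>v x) \<bullet> (W *\<^sub>v y) = (transpose_mat W *\<^sub>v (W *\<^sub>v x)) \<bullet> y"
    using transpose_vec_mult_scalar[OF W y, of "W *\<^sub>v x"] W x by auto
  also have "transpose_mat W *\<^sub>v (W *\<^sub>v x) = x"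
    using W x WW by (metis assoc_mult_mat_vec carrier_matD(1) carrier_matI index_transpose_mat(2,3)
        one_mult_mat_vec)
  finally show ?thesis .
qed

lemma eigenvalue_of_real_symmetric_is_real:
  fixes A :: "real mat"
  assumes A: "A \<in> carrier_mat n n" and sym: "transpose_mat A = A"
    and e: "eigenvalue (map_mat complex_of_real A) e"
  shows "e \<in> \<real>"
proof -
  obtain v where v: "v \<in> carrier_vec n" "v \<noteq> 0\<^sub>v n" "map_mat complex_of_real A *\<^sub>v v = e \<cdot>\<^sub>v v"
    using e A unfolding eigenvalue_def eigenvector_def by auto
  have row: "(\<Sum>j<n. complex_of_real (A $$ (i, j)) * v $ j) = e * v $ i" if i: "i < n" for i
  proof -
    have "(map_mat complex_of_real A *\<^sub>v v) $ i = (\<Sum>j<n. complex_of_real (A $$ (i, j)) * v $ j)"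
      using i A v(1) by (auto simp: scalar_prod_def row_def lessThan_atLeast0 intro!: sum.cong)
    then show ?thesis using v(3) i v(1) by simp
  qed
  text \<open>The Hermitian form of v is real and equals e times the (positive) squared norm of v.\<close>
  define s where "s = (\<Sum>i<n. \<Sum>j<n. complex_of_real (A $$ (i, j)) * cnj (v $ i) * v $ j)"
  define t where "t = (\<Sum>i<n. (cmod (v $ i))\<^sup>2)"
  have "s = (\<Sum>i<n. cnj (v $ i) * (\<Sum>j<n. complex_of_real (A $$ (i, j)) * v $ j))"
    unfolding s_def by (simp add: sum_distrib_left mult_ac)
  also have "\<dots> = e * (\<Sum>i<n. cnj (v $ i) * v $ i)" using row by (simp add: sum_distrib_left mult_ac)
  also have "(\<Sum>i<n. cnj (v $ i) * v $ i) = complex_of_real t"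
    unfolding t_def of_real_sum by (intro sum.cong refl) (metis complex_norm_square of_real_power mult.commute)
  finally have st: "s = e * complex_of_real t" .
  have "cnj s = (\<Sum>j<n. \<Sum>i<n. complex_of_real (A $$ (i, j)) * v $ i * cnj (v $ j))"
    unfolding s_def by (subst sum.swap) (simp add: mult_ac)
  also have "\<dots> = s" unfolding s_def
  proof (intro sum.cong refl)
    fix i j assume "i \<in> {..<n}" "j \<in> {..<n}"
    then have "A $$ (j, i) = A $$ (i, j)" using A sym by (metis carrier_matD index_transpose_mat(1) lessThan_iff)
    then show "complex_of_real (A $$ (j, i)) * v $ j * cnj (v $ i)
        = complex_of_real (A $$ (i, j)) * cnj (v $ i) * v $ j" by (simp add: mult_ac)
  qed
  finally have cs: "cnj s = s" .
  obtain i0 where i0: "i0 < n" "v $ i0 \<noteq> 0" using v by (metis eq_vecI carrier_vecD index_zero_vec(1,2))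
  have "0 < (cmod (v $ i0))\<^sup>2" using i0 by simp
  also have "\<dots> \<le> t" unfolding t_def using i0 by (intro member_le_sum) auto
  finally have "t \<noteq> 0" by simp
  then have "cnj e = e" using cs st by (simp add: complex_cnj_mult)
  then show ?thesis by (simp add: Reals_cnj_iff)
qed

lemma real_symmetric_mat_has_eigenvalue:
  fixes A :: "real mat"
  assumes A: "A \<in> carrier_mat n n" and sym: "transpose_mat A = A" and n: "n > 0"
  shows "\<exists>r. eigenvalue A r"
proof -
  define Ac where "Ac = map_mat complex_of_real A"
  have Ac: "Ac \<in> carrier_mat n n" using A Ac_def by auto
  obtain es where cp: "char_poly Ac = (\<Prod>a\<leftarrow>es. [:- a, 1:])" and "length es = n"
    using char_poly_factorized[OF Ac] by blast
  with n obtain e es' where "es = e # es'" by (cases es) auto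
  then have "eigenvalue Ac e" using eigenvalue_root_char_poly[OF Ac] cp by simp
  then have "e \<in> \<real>" using eigenvalue_of_real_symmetric_is_real[OF A sym] Ac_def by simp
  then obtain r where r: "e = complex_of_real r" by (metis Reals_cases)
  have "complex_of_real (poly (char_poly A) r) = poly (char_poly Ac) e"
    unfolding Ac_def r of_real_hom.char_poly_hom[OF A] by (rule of_real_hom.poly_map_poly[symmetric])
  also have "\<dots> = 0" using \<open>eigenvalue Ac e\<close> eigenvalue_root_char_poly[OF Ac] by simp
  finally show ?thesis using eigenvalue_root_char_poly[OF A] by auto
qed

definition orthonormal_eigenbasis :: "nat \<Rightarrow> real mat \<Rightarrow> real vec list \<Rightarrow> real list \<Rightarrow> bool" where
  "orthonormal_eigenbasis n A us ds \<longleftrightarrow> length us = n \<and> length ds = n \<and> orthonormal n us \<and>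
     (\<forall>i<n. A *\<^sub>v us ! i = ds ! i \<cdot>\<^sub>v us ! i)"

lemma orthonormal_eigenbasisD:
  assumes "orthonormal_eigenbasis n A us ds" and "i < n"
  shows "us ! i \<in> carrier_vec n" "j < n \<Longrightarrow> us ! j \<bullet> us ! i = (if j = i then 1 else 0)"
    "A *\<^sub>v us ! i = ds ! i \<cdot>\<^sub>v us ! i"
  using assms by (auto simp: orthonormal_eigenbasis_def orthonormal_def)

lemma orthonormal_eigenbasis_eigenvalue:
  assumes A: "A \<in> carrier_mat n n" and eb: "orthonormal_eigenbasis n A us ds" and i: "i < n"
  shows "eigenvalue A (ds ! i)"
proof -
  have "us ! i \<noteq> 0\<^sub>v n" using orthonormal_eigenbasisD(2)[OF eb i i] by auto
  then show ?thesis using orthonormal_eigenbasisD[OF eb i] A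
    unfolding eigenvalue_def eigenvector_def by auto
qed

lemma orthonormal_eigenbasis_conjugate:
  fixes A W :: "real mat"
  assumes A: "A \<in> carrier_mat n n" and W: "W \<in> carrier_mat n n"
    and WW: "transpose_mat W * W = 1\<^sub>m n" and WW': "W * transpose_mat W = 1\<^sub>m n"
    and eb: "orthonormal_eigenbasis n (transpose_mat W * A * W) zs ds"
  shows "orthonormal_eigenbasis n A (map ((*\<^sub>v) W) zs) ds"
proof -
  have WT: "transpose_mat W \<in> carrier_mat n n" using W by auto
  have "W * (transpose_mat W * A * W) = (W * transpose_mat W) * A * W"
    using W WT A by (simp add: assoc_mult_mat[of _ n n _ n _ n])
  then have AW: "A * W = W * (transpose_mat W * A * W)" using WW' A by simp
  have lzs: "length zs = n" using eb unfolding orthonormal_eigenbasis_def by simp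
  have ev: "A *\<^sub>v (W *\<^sub>v zs ! i) = ds ! i \<cdot>\<^sub>v (W *\<^sub>v zs ! i)" if i: "i < n" for i
  proof -
    note z = orthonormal_eigenbasisD[OF eb i]
    have "A *\<^sub>v (W *\<^sub>v zs ! i) = (A * W) *\<^sub>v zs ! i" using A W z(1) by simp
    also have "\<dots> = W *\<^sub>v ((transpose_mat W * A * W) *\<^sub>v zs ! i)"
      unfolding AW using W WT A z(1) by (subst assoc_mult_mat_vec) auto
    also have "\<dots> = ds ! i \<cdot>\<^sub>v (W *\<^sub>v zs ! i)" using z(1,3) W by (simp add: mult_mat_vec)
    finally show ?thesis .
  qed
  have "(W *\<^sub>v zs ! j) \<bullet> (W *\<^sub>v zs ! i) = (if j = i then 1 else 0)" if "i < n" "j < n" for i j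
    using orthogonal_mat_scalar_prod[OF W WW] orthonormal_eigenbasisD[OF eb] that by simp
  then show ?thesis
    using ev lzs W orthonormal_eigenbasisD(1)[OF eb] eb
    unfolding orthonormal_eigenbasis_def orthonormal_def by (auto simp: in_set_conv_nth)
qed

lemma orthonormal_eigenbasis_Cons:
  fixes A :: "real mat"
  assumes A: "A \<in> carrier_mat (Suc n) (Suc n)" and sym: "transpose_mat A = A"
    and col0: "\<And>i. i < Suc n \<Longrightarrow> A $$ (i, 0) = (if i = 0 then e else 0)"
    and eb: "orthonormal_eigenbasis n (mat n n (\<lambda>(i, j). A $$ (Suc i, Suc j))) us ds"
  shows "orthonormal_eigenbasis (Suc n) A (unit_vec (Suc n) 0 # map (vCons 0) us) (e # ds)"
proof -
  define B where "B = mat n n (\<lambda>(i, j). A $$ (Suc i, Suc j))"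
  note ebB = orthonormal_eigenbasisD[OF eb[folded B_def]]
  have row0: "A $$ (0, j) = (if j = 0 then e else 0)" if "j < Suc n" for j
    using col0[OF that] A sym that by (metis carrier_matD index_transpose_mat(1) zero_less_Suc)
  have Av: "A *\<^sub>v vCons a y = vCons (e * a) (B *\<^sub>v y)" if y: "y \<in> carrier_vec n" for a y
  proof (rule eq_vecI)
    fix i assume "i < dim_vec (vCons (e * a) (B *\<^sub>v y))"
    then have i: "i < Suc n" by (simp add: B_def)
    have "(A *\<^sub>v vCons a y) $ i = (\<Sum>j<Suc n. A $$ (i, j) * vCons a y $ j)"
      using A i y by (auto simp: scalar_prod_def row_def lessThan_atLeast0 intro!: sum.cong)
    also have "\<dots> = A $$ (i, 0) * a + (\<Sum>j<n. A $$ (i, Suc j) * y $ j)"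
      by (subst sum.lessThan_Suc_shift) simp
    finally show "(A *\<^sub>v vCons a y) $ i = vCons (e * a) (B *\<^sub>v y) $ i"
      using i y col0 row0 by (cases i) (auto simp: B_def scalar_prod_def lessThan_atLeast0)
  qed (use A B_def in auto)
  have u0: "unit_vec (Suc n) 0 = vCons 1 (0\<^sub>v n)"
    by (auto intro!: eq_vecI simp: unit_vec_def vCons_def split: nat.split)
  let ?us = "unit_vec (Suc n) 0 # map (vCons 0) us"
  have len: "length us = n" "length ds = n" using eb unfolding orthonormal_eigenbasis_def by auto
  have carr: "?us ! i \<in> carrier_vec (Suc n)" if "i < Suc n" for i
    using that ebB(1) len by (cases i) auto
  have ip: "?us ! i \<bullet> ?us ! j = (if i = j then 1 else 0)" if "i < Suc n" "j < Suc n" for i j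
    using that ebB(1,2) len unfolding u0 by (cases i; cases j) auto
  have ev: "A *\<^sub>v ?us ! i = (e # ds) ! i \<cdot>\<^sub>v ?us ! i" if "i < Suc n" for i
  proof (cases i)
    case 0 then show ?thesis unfolding u0 using Av[of "0\<^sub>v n" 1] B_def
      by (auto intro!: eq_vecI simp: vCons_def split: nat.split)
  next
    case (Suc k)
    with that have k: "k < n" by simp
    show ?thesis using Av[OF ebB(1)[OF k], of 0] ebB(3)[OF k] Suc k len
      by (auto intro!: eq_vecI simp: vCons_def split: nat.split)
  qed
  have "set ?us \<subseteq> carrier_vec (Suc n)"
  proof
    fix x assume "x \<in> set ?us"
    then obtain i where "i < length ?us" "x = ?us ! i" by (metis in_set_conv_nth)
    then show "x \<in> carrier_vec (Suc n)" using carr len by simp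
  qed
  then show ?thesis unfolding orthonormal_eigenbasis_def orthonormal_def
    using ip ev len by simp
qed

lemma orthonormal_eigenbasis_deflation:
  fixes A :: "real mat"
  assumes A: "A \<in> carrier_mat (Suc n) (Suc n)" and sym: "transpose_mat A = A"
    and v: "v \<in> carrier_vec (Suc n)" "v \<bullet> v = 1" "A *\<^sub>v v = e \<cdot>\<^sub>v v"
  obtains B where "B \<in> carrier_mat n n" "transpose_mat B = B"
    "\<And>us ds. orthonormal_eigenbasis n B us ds \<Longrightarrow> \<exists>us'. orthonormal_eigenbasis (Suc n) A us' (e # ds)"
proof -
  obtain ws where ws: "length ws = Suc n" "orthonormal (Suc n) ws" "ws ! 0 = v"
    using orthonormal_basis_extension[OF v(1,2)] by blast
  define W where "W = mat_of_cols (Suc n) ws"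
  note W = orthonormal_mat_of_cols[OF ws(2,1), folded W_def]
  have WT: "transpose_mat W \<in> carrier_mat (Suc n) (Suc n)" using W by auto
  define A' where "A' = transpose_mat W * A * W"
  have A': "A' \<in> carrier_mat (Suc n) (Suc n)" using A W unfolding A'_def by auto
  have "transpose_mat A' = transpose_mat W * transpose_mat (transpose_mat W * A)"
    unfolding A'_def using transpose_mult[OF mult_carrier_mat[OF WT A] W(1)] by simp
  also have "transpose_mat (transpose_mat W * A) = A * W" using transpose_mult[OF WT A] sym by simp
  finally have sym': "transpose_mat A' = A'" using assoc_mult_mat[OF WT A W(1)] A'_def by simp
  have colW: "col W j = ws ! j" if "j < Suc n" for j
    unfolding W_def using ws that by (intro col_mat_of_cols) (auto simp: orthonormal_def)
  have col0: "A' $$ (i, 0) = (if i = 0 then e else 0)" if i: "i < Suc n" for i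
  proof -
    have "A' $$ (i, 0) = ws ! i \<bullet> (A *\<^sub>v ws ! 0)"
      unfolding A'_def using A W WT i colW
      by (simp add: assoc_mult_mat[OF WT A W(1)] col_mult2 mult_mat_vec_def)
    also have "\<dots> = e * (ws ! i \<bullet> ws ! 0)"
      using ws v i by (simp add: orthonormal_def subset_iff)
    finally show ?thesis using ws(1,2) i by (simp add: orthonormal_def)
  qed
  define B where "B = mat n n (\<lambda>(i, j). A' $$ (Suc i, Suc j))"
  show ?thesis
  proof (rule that[of B])
    show "B \<in> carrier_mat n n" by (simp add: B_def)
    show "transpose_mat B = B" unfolding B_def
      by (rule eq_matI) (use sym' A' in \<open>auto, metis Suc_less_eq carrier_matD index_transpose_mat(1)\<close>)
    fix us ds assume "orthonormal_eigenbasis n B us ds"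
    then have "orthonormal_eigenbasis (Suc n) A' (unit_vec (Suc n) 0 # map (vCons 0) us) (e # ds)"
      using orthonormal_eigenbasis_Cons[OF A' sym' col0] by (simp add: B_def)
    then have "orthonormal_eigenbasis (Suc n) A
        (map ((*\<^sub>v) W) (unit_vec (Suc n) 0 # map (vCons 0) us)) (e # ds)"
      unfolding A'_def by (rule orthonormal_eigenbasis_conjugate[OF A W(1-3)])
    then show "\<exists>us'. orthonormal_eigenbasis (Suc n) A us' (e # ds)" by blast
  qed
qed

theorem real_symmetric_sorted_eigenbasis:
  fixes A :: "real mat"
  assumes "A \<in> carrier_mat n n" and "transpose_mat A = A"
  shows "\<exists>us ds. orthonormal_eigenbasis n A us ds \<and> sorted_wrt (\<ge>) ds"
  using assms
proof (induction n arbitrary: A)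
  case 0
  then show ?case by (auto simp: orthonormal_eigenbasis_def orthonormal_def)
next
  case (Suc n)
  note A = Suc.prems(1) and sym = Suc.prems(2)
  define EV where "EV = {r. eigenvalue A r}"
  have "EV = {x. poly (char_poly A) x = 0}" using eigenvalue_root_char_poly[OF A] EV_def by auto
  moreover have "char_poly A \<noteq> 0" using degree_monic_char_poly[OF A] by auto
  ultimately have "finite EV" using poly_roots_finite by simp
  moreover have "EV \<noteq> {}" using real_symmetric_mat_has_eigenvalue[OF A sym] EV_def by auto
  ultimately have "Max EV \<in> EV" "\<forall>r\<in>EV. r \<le> Max EV" by auto
  text \<open>Deflating along an eigenvector of the largest eigenvalue puts that eigenvalue first.\<close>
  define e where "e = Max EV"
  have emax: "r \<le> e" if "eigenvalue A r" for r using that \<open>\<forall>r\<in>EV. r \<le> Max EV\<close> EV_def e_def by simp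
  obtain v where v: "v \<in> carrier_vec (Suc n)" "v \<noteq> 0\<^sub>v (Suc n)" "A *\<^sub>v v = e \<cdot>\<^sub>v v"
    using \<open>Max EV \<in> EV\<close> A unfolding EV_def eigenvalue_def eigenvector_def e_def by auto
  define v1 where "v1 = (1 / sqrt (v \<bullet> v)) \<cdot>\<^sub>v v"
  have "v \<bullet> v > 0" using conjugate_square_greater_0_vec[OF v(1)] v(2) by simp
  then have v1: "v1 \<in> carrier_vec (Suc n)" "v1 \<bullet> v1 = 1" "A *\<^sub>v v1 = e \<cdot>\<^sub>v v1"
    using v A unfolding v1_def
    by (auto simp: smult_scalar_prod_distrib scalar_prod_smult_distrib mult_mat_vec smult_smult_assoc
        mult.commute)
  obtain B where B: "B \<in> carrier_mat n n" "transpose_mat B = B"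
    and lift: "\<And>us ds. orthonormal_eigenbasis n B us ds \<Longrightarrow> \<exists>us'. orthonormal_eigenbasis (Suc n) A us' (e # ds)"
    using orthonormal_eigenbasis_deflation[OF A sym v1] by blast
  obtain us ds where "orthonormal_eigenbasis n B us ds" and srt: "sorted_wrt (\<ge>) ds"
    using Suc.IH[OF B] by blast
  with lift obtain us' where eb: "orthonormal_eigenbasis (Suc n) A us' (e # ds)" by blast
  have "d \<le> e" if "d \<in> set ds" for d
  proof -
    from that obtain i where "i < n" "d = ds ! i"
      using eb by (auto simp: orthonormal_eigenbasis_def in_set_conv_nth)
    then show ?thesis using orthonormal_eigenbasis_eigenvalue[OF A eb, of "Suc i"] emax by simp
  qed
  with srt have "sorted_wrt (\<ge>) (e # ds)" by simp
  with eb show ?case by blast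
qed

section \<open>Courant--Fischer comparison of sorted eigenvalues\<close>

lemma scalar_prod_sum_lessThan:
  "x \<in> carrier_vec n \<Longrightarrow> y \<in> carrier_vec n \<Longrightarrow> x \<bullet> y = (\<Sum>i<n. x $ i * y $ i)"
  by (auto simp: scalar_prod_def lessThan_atLeast0)

lemma orthonormal_eigenbasis_diagonalizes:
  fixes A :: "real mat"
  assumes A: "A \<in> carrier_mat n n" and eb: "orthonormal_eigenbasis n A us ds"
  shows "A * mat_of_cols n us = mat_of_cols n us * mat n n (\<lambda>(i, j). if i = j then ds ! i else 0)"
proof (rule eq_matI)
  define U where "U = mat_of_cols n us"
  note ebD = orthonormal_eigenbasisD[OF eb]
  have len: "length us = n" using eb by (simp add: orthonormal_eigenbasis_def)
  have colU: "col U j = us ! j" if "j < n" for j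
    unfolding U_def using len ebD(1)[OF that] that by (intro col_mat_of_cols) auto
  fix i j assume "i < dim_row (U * mat n n (\<lambda>(i, j). if i = j then ds ! i else 0))"
    and "j < dim_col (U * mat n n (\<lambda>(i, j). if i = j then ds ! i else 0))"
  then have i: "i < n" and j: "j < n" by (auto simp: U_def)
  have "(U * mat n n (\<lambda>(i, j). if i = j then ds ! i else 0)) $$ (i, j)
      = (\<Sum>l<n. U $$ (i, l) * (if l = j then ds ! l else 0))"
    using i j len by (auto simp: U_def scalar_prod_def lessThan_atLeast0 intro!: sum.cong)
  also have "\<dots> = (\<Sum>l<n. if l = j then U $$ (i, j) * ds ! j else 0)" by (intro sum.cong) auto
  also have "\<dots> = ds ! j * (us ! j) $ i"
  proof -
    have "U $$ (i, j) = col U j $ i" using i j len by (simp add: U_def)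
    then show ?thesis using colU[OF j] j by simp
  qed
  also have "\<dots> = (A *\<^sub>v col U j) $ i" using ebD(1,3)[OF j] colU[OF j] i by simp
  also have "\<dots> = (A * U) $$ (i, j)" using A i j len by (simp add: U_def)
  finally show "(A * mat_of_cols n us) $$ (i, j)
      = (mat_of_cols n us * mat n n (\<lambda>(i, j). if i = j then ds ! i else 0)) $$ (i, j)"
    unfolding U_def by simp
qed (use A eb in \<open>auto simp: orthonormal_eigenbasis_def\<close>)

lemma orthonormal_eigenbasis_quadratic_form:
  fixes A :: "real mat"
  assumes A: "A \<in> carrier_mat n n" and eb: "orthonormal_eigenbasis n A us ds"
    and c: "c \<in> carrier_vec n"
  shows "(mat_of_cols n us *\<^sub>v c) \<bullet> (A *\<^sub>v (mat_of_cols n us *\<^sub>v c)) = (\<Sum>i<n. ds ! i * (c $ i)\<^sup>2)"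
proof -
  define U where "U = mat_of_cols n us"
  define D where "D = mat n n (\<lambda>(i, j). if i = j then ds ! i else 0)"
  have len: "length us = n" using eb by (simp add: orthonormal_eigenbasis_def)
  note U = orthonormal_mat_of_cols[of n us, folded U_def]
  have U: "U \<in> carrier_mat n n" "transpose_mat U * U = 1\<^sub>m n"
    using U eb len by (auto simp: orthonormal_eigenbasis_def)
  have D: "D \<in> carrier_mat n n" by (simp add: D_def)
  have Dc: "D *\<^sub>v c = vec n (\<lambda>i. ds ! i * c $ i)"
  proof (rule eq_vecI)
    fix i assume "i < dim_vec (vec n (\<lambda>i. ds ! i * c $ i))"
    then have i: "i < n" by simp
    have "(D *\<^sub>v c) $ i = (\<Sum>j<n. (if i = j then ds ! i else 0) * c $ j)"
      using c i by (auto simp: D_def scalar_prod_def lessThan_atLeast0 intro!: sum.cong)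
    also have "\<dots> = (\<Sum>j<n. if j = i then ds ! i * c $ i else 0)" by (intro sum.cong) auto
    also have "\<dots> = ds ! i * c $ i" using i by simp
    finally show "(D *\<^sub>v c) $ i = vec n (\<lambda>i. ds ! i * c $ i) $ i" using i by simp
  qed (simp add: D_def)
  have "A *\<^sub>v (U *\<^sub>v c) = (A * U) *\<^sub>v c" using A U c by simp
  also have "\<dots> = (U * D) *\<^sub>v c"
    using orthonormal_eigenbasis_diagonalizes[OF A eb] by (simp add: U_def D_def)
  also have "\<dots> = U *\<^sub>v (D *\<^sub>v c)" using U D c by simp
  finally have "(U *\<^sub>v c) \<bullet> (A *\<^sub>v (U *\<^sub>v c)) = c \<bullet> (D *\<^sub>v c)"
    using orthogonal_mat_scalar_prod[OF U c, of "D *\<^sub>v c"] D c by simp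
  also have "\<dots> = (\<Sum>i<n. ds ! i * (c $ i)\<^sup>2)"
    unfolding Dc using c by (simp add: scalar_prod_sum_lessThan power2_eq_square mult_ac)
  finally show ?thesis unfolding U_def .
qed

lemma char_poly_orthonormal_eigenbasis:
  fixes A :: "real mat"
  assumes A: "A \<in> carrier_mat n n" and eb: "orthonormal_eigenbasis n A us ds"
  shows "char_poly A = (\<Prod>a\<leftarrow>ds. [:- a, 1:])"
proof -
  define U where "U = mat_of_cols n us"
  define D where "D = mat n n (\<lambda>(i, j). if i = j then ds ! i else 0)"
  have len: "length us = n" "length ds = n" using eb by (auto simp: orthonormal_eigenbasis_def)
  have "orthonormal n us" using eb by (simp add: orthonormal_eigenbasis_def)
  note U = orthonormal_mat_of_cols[OF this len(1), folded U_def]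
  have UT: "transpose_mat U \<in> carrier_mat n n" using U by auto
  have D: "D \<in> carrier_mat n n" by (simp add: D_def)
  have "A = (A * U) * transpose_mat U" using U A UT by simp
  also have "A * U = U * D"
    using orthonormal_eigenbasis_diagonalizes[OF A eb] by (simp add: U_def D_def)
  finally have "similar_mat_wit A D U (transpose_mat U)"
    unfolding similar_mat_wit_def Let_def using U D UT A by auto
  then have "char_poly A = char_poly D"
    by (intro char_poly_similar) (auto simp: similar_mat_def)
  also have "\<dots> = (\<Prod>a\<leftarrow>diag_mat D. [:- a, 1:])"
    by (rule char_poly_upper_triangular[OF D]) (auto simp: D_def)
  also have "diag_mat D = ds" using len by (auto simp: diag_mat_def D_def intro!: nth_equalityI)
  finally show ?thesis .
qed

lemma proots_prod_list_linear: "proots (\<Prod>a\<leftarrow>as. [:- a, 1:]) = mset (as :: real list)"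
proof (induction as)
  case (Cons a as)
  have "(\<Prod>a\<leftarrow>as. [:- a, 1:]) \<noteq> (0 :: real poly)" by (auto simp: prod_list_zero_iff)
  then have "proots ([:- a, 1:] * (\<Prod>a\<leftarrow>as. [:- a, 1:]))
      = proots [:- a, 1:] + proots (\<Prod>a\<leftarrow>as. [:- a, 1:])"
    by (intro proots_mult) auto
  then show ?case using Cons proots_linear_factor[of "- a"] by simp
qed simp

lemma sorted_desc_eq_of_prod_list_linear_eq:
  fixes as bs :: "real list"
  assumes "sorted_wrt (\<ge>) as" "sorted_wrt (\<ge>) bs"
    and "(\<Prod>a\<leftarrow>as. [:- a, 1:]) = (\<Prod>b\<leftarrow>bs. [:- b, 1:])"
  shows "as = bs"
proof -
  have "mset (rev as) = mset (rev bs)"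
    using arg_cong[OF assms(3), of proots] by (simp add: proots_prod_list_linear)
  moreover have "sorted (rev as)" "sorted (rev bs)" using assms(1,2) by (simp_all add: sorted_wrt_rev)
  ultimately show ?thesis by (metis properties_for_sort rev_rev_ident sorted_sort_id)
qed

lemma sorted_desc_weighted_sum_ge:
  fixes ds :: "real list" and c :: "nat \<Rightarrow> real"
  assumes "sorted_wrt (\<ge>) ds" "length ds = n" "k < n" "\<And>i. k < i \<Longrightarrow> i < n \<Longrightarrow> c i = 0"
  shows "ds ! k * (\<Sum>i<n. (c i)\<^sup>2) \<le> (\<Sum>i<n. ds ! i * (c i)\<^sup>2)"
  unfolding sum_distrib_left
proof (rule sum_mono)
  fix i assume "i \<in> {..<n}"
  then have "ds ! k \<le> ds ! i \<or> c i = 0"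
    using assms sorted_wrt_nth_less[OF assms(1), of i k] by (cases "i < k"; cases "i = k") auto
  then show "ds ! k * (c i)\<^sup>2 \<le> ds ! i * (c i)\<^sup>2" by (auto intro: mult_right_mono)
qed

lemma sorted_desc_weighted_sum_le:
  fixes ds :: "real list" and c :: "nat \<Rightarrow> real"
  assumes "sorted_wrt (\<ge>) ds" "length ds = n" "k < n" "\<And>i. i < k \<Longrightarrow> c i = 0"
  shows "(\<Sum>i<n. ds ! i * (c i)\<^sup>2) \<le> ds ! k * (\<Sum>i<n. (c i)\<^sup>2)"
  unfolding sum_distrib_left
proof (rule sum_mono)
  fix i assume "i \<in> {..<n}"
  then have "ds ! i \<le> ds ! k \<or> c i = 0"
    using assms sorted_wrt_nth_less[OF assms(1), of k i] by (cases "k < i"; cases "i = k") auto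
  then show "ds ! i * (c i)\<^sup>2 \<le> ds ! k * (c i)\<^sup>2" by (auto intro: mult_right_mono)
qed

lemma exists_nonzero_prefix_vec_in_kernel_of_rows:
  fixes G :: "real mat"
  assumes G: "G \<in> carrier_mat n n" and k: "k < n"
  shows "\<exists>c \<in> carrier_vec n. c \<noteq> 0\<^sub>v n \<and> (\<forall>i<n. k < i \<longrightarrow> c $ i = 0) \<and>
           (\<forall>j<k. (G *\<^sub>v c) $ j = 0)"
proof -
  text \<open>k homogeneous equations in k + 1 unknowns: pad them with a zero row and take a determinant.\<close>
  define H where "H = mat\<^sub>r (Suc k) (Suc k)
    (\<lambda>j. if j = k then 0\<^sub>v (Suc k) else vec (Suc k) (\<lambda>i. G $$ (j, i)))"
  have "det H = 0" unfolding H_def by (rule det_row_0) auto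
  then obtain v where v: "v \<in> carrier_vec (Suc k)" "v \<noteq> 0\<^sub>v (Suc k)" "H *\<^sub>v v = 0\<^sub>v (Suc k)"
    using det_0_iff_vec_prod_zero_field[of H "Suc k"] H_def by auto
  define c where "c = vec n (\<lambda>i. if i \<le> k then v $ i else 0)"
  have "c \<noteq> 0\<^sub>v n"
  proof
    assume "c = 0\<^sub>v n"
    have "v $ i = 0" if "i < Suc k" for i
    proof -
      have "i < n" using that k by simp
      then have "c $ i = 0" using \<open>c = 0\<^sub>v n\<close> by simp
      then show ?thesis using \<open>i < n\<close> that by (simp add: c_def)
    qed
    then show False using v(1,2) by (auto intro!: eq_vecI)
  qed
  moreover have "(G *\<^sub>v c) $ j = 0" if j: "j < k" for j
  proof -
    have "(G *\<^sub>v c) $ j = (\<Sum>i<n. G $$ (j, i) * c $ i)"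
      using G j k by (auto simp: c_def scalar_prod_def lessThan_atLeast0 intro!: sum.cong)
    also have "\<dots> = (\<Sum>i<Suc k. G $$ (j, i) * v $ i)"
      using k by (intro sum.mono_neutral_cong_right) (auto simp: c_def)
    also have "\<dots> = (H *\<^sub>v v) $ j"
      using v(1) j by (auto simp: H_def scalar_prod_def lessThan_atLeast0 intro!: sum.cong)
    finally show ?thesis using v(3) j by simp
  qed
  ultimately show ?thesis by (intro bexI[of _ c]) (auto simp: c_def)
qed

lemma sorted_eigenvalue_le_of_quadratic_form_le:
  fixes A B :: "real mat"
  assumes A: "A \<in> carrier_mat n n" and B: "B \<in> carrier_mat n n"
    and ebA: "orthonormal_eigenbasis n A us ds" and srt: "sorted_wrt (\<ge>) ds"
    and ebB: "orthonormal_eigenbasis n B vs es" and srt': "sorted_wrt (\<ge>) es"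
    and form: "\<And>x. x \<in> carrier_vec n \<Longrightarrow> x \<bullet> (A *\<^sub>v x) \<le> \<alpha> * (x \<bullet> (B *\<^sub>v x)) + \<beta> * (x \<bullet> x)"
    and alpha: "\<alpha> \<ge> 0" and k: "k < n"
  shows "ds ! k \<le> \<alpha> * es ! k + \<beta>"
proof -
  text \<open>Test the form inequality on a vector in the span of the first k + 1 eigenvectors of A
    that is orthogonal to the first k eigenvectors of B.\<close>
  define U where "U = mat_of_cols n us"
  define V where "V = mat_of_cols n vs"
  have len: "length us = n" "length ds = n" "length vs = n" "length es = n"
    using ebA ebB by (auto simp: orthonormal_eigenbasis_def)
  have "orthonormal n us" "orthonormal n vs" using ebA ebB by (auto simp: orthonormal_eigenbasis_def)
  note U = orthonormal_mat_of_cols[OF this(1) len(1), folded U_def]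
    and V = orthonormal_mat_of_cols[OF this(2) len(3), folded V_def]
  have VT: "transpose_mat V \<in> carrier_mat n n" using V by auto
  obtain c where c: "c \<in> carrier_vec n" "c \<noteq> 0\<^sub>v n" "\<And>i. k < i \<Longrightarrow> i < n \<Longrightarrow> c $ i = 0"
      and Gc: "\<And>j. j < k \<Longrightarrow> (transpose_mat V * U *\<^sub>v c) $ j = 0"
    using exists_nonzero_prefix_vec_in_kernel_of_rows[of "transpose_mat V * U" n k] U V k by auto
  define f where "f = U *\<^sub>v c"
  define y where "y = transpose_mat V *\<^sub>v f"
  have f: "f \<in> carrier_vec n" and y: "y \<in> carrier_vec n" using U VT c by (auto simp: f_def y_def)
  have fy: "f = V *\<^sub>v y" using V f by (simp add: y_def assoc_mult_mat_vec[symmetric, OF V(1) VT f])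
  have y0: "y $ j = 0" if "j < k" for j
    using Gc[OF that] U VT c by (simp add: y_def f_def)
  have ff: "f \<bullet> f = c \<bullet> c" unfolding f_def by (rule orthogonal_mat_scalar_prod[OF U(1,2) c(1) c(1)])
  have yy: "y \<bullet> y = c \<bullet> c" using orthogonal_mat_scalar_prod[OF V(1,2) y y] fy ff by simp
  have "c \<bullet> c > 0" using c(1,2) conjugate_square_greater_0_vec[OF c(1)] by simp
  moreover have "ds ! k * (c \<bullet> c) \<le> f \<bullet> (A *\<^sub>v f)"
    using sorted_desc_weighted_sum_ge[OF srt len(2) k, of "\<lambda>i. c $ i"] c
      orthonormal_eigenbasis_quadratic_form[OF A ebA c(1)]
    by (simp add: f_def U_def scalar_prod_sum_lessThan power2_eq_square)
  moreover have "f \<bullet> (B *\<^sub>v f) \<le> es ! k * (c \<bullet> c)"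
    using sorted_desc_weighted_sum_le[OF srt' len(4) k, of "\<lambda>i. y $ i"] y0 y yy
      orthonormal_eigenbasis_quadratic_form[OF B ebB y]
    by (simp add: fy V_def scalar_prod_sum_lessThan power2_eq_square)
  ultimately have "ds ! k * (c \<bullet> c) \<le> (\<alpha> * es ! k + \<beta>) * (c \<bullet> c)"
    using form[OF f] ff alpha mult_left_mono[of "f \<bullet> (B *\<^sub>v f)" "es ! k * (c \<bullet> c)" \<alpha>]
    by (simp add: algebra_simps)
  with \<open>c \<bullet> c > 0\<close> show ?thesis by simp
qed

section \<open>Matrices acting on functions\<close>

definition mapply :: "'a set \<Rightarrow> 'b set \<Rightarrow> ('a \<Rightarrow> 'b \<Rightarrow> real) \<Rightarrow> ('b \<Rightarrow> real) \<Rightarrow> 'a \<Rightarrow> real" where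
  "mapply S1 S2 X g = (\<lambda>a. if a \<in> S1 then \<Sum>b\<in>S2. X a b * g b else 0)"

definition l2_inner :: "'a set \<Rightarrow> ('a \<Rightarrow> real) \<Rightarrow> ('a \<Rightarrow> real) \<Rightarrow> ('a \<Rightarrow> real) \<Rightarrow> real" where
  "l2_inner S w g h = (\<Sum>a\<in>S. w a * g a * h a)"

lemma mapply_diff: "mapply S1 S2 X (g - h) = mapply S1 S2 X g - mapply S1 S2 X h"
  by (auto simp: mapply_def fun_eq_iff algebra_simps sum_subtractf)

lemma mapply_mmult: "mapply S1 S3 (mmult S2 X Y) g = mapply S1 S2 X (mapply S2 S3 Y g)"
proof (rule ext)
  fix a
  have "(\<Sum>c\<in>S3. (\<Sum>b\<in>S2. X a b * Y b c) * g c) = (\<Sum>b\<in>S2. X a b * (\<Sum>c\<in>S3. Y b c * g c))"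
    by (simp add: sum_distrib_left sum_distrib_right mult_ac sum.swap[of _ S3])
  then show "mapply S1 S3 (mmult S2 X Y) g a = mapply S1 S2 X (mapply S2 S3 Y g) a"
    by (auto simp: mapply_def mmult_def intro: sum.cong)
qed

lemma mapply_cong:
  "(\<And>a b. a \<in> S1 \<Longrightarrow> b \<in> S2 \<Longrightarrow> X a b = Y a b) \<Longrightarrow> mapply S1 S2 X = mapply S1 S2 Y"
  by (auto simp: mapply_def fun_eq_iff intro!: sum.cong)

lemma mapply_mid: "finite S \<Longrightarrow> (\<And>x. x \<notin> S \<Longrightarrow> g x = 0) \<Longrightarrow> mapply S S mid g = g"
  by (auto simp: mapply_def mid_def fun_eq_iff if_distrib[of "\<lambda>c. c * _"] cong: if_cong)

lemma mapply_mprod_list: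
  "mapply S S (mprod_list S Xs) g = foldr (mapply S S) Xs (mapply S S mid g)"
  by (induction Xs) (simp_all add: mprod_list_def mapply_mmult)

lemma l2_inner_commute: "l2_inner S w g h = l2_inner S w h g"
  by (simp add: l2_inner_def mult_ac)

lemma l2_inner_diff_left: "l2_inner S w (g - h) k = l2_inner S w g k - l2_inner S w h k"
  by (simp add: l2_inner_def algebra_simps sum_subtractf)

lemma l2_inner_diff_right: "l2_inner S w k (g - h) = l2_inner S w k g - l2_inner S w k h"
  by (simp add: l2_inner_def algebra_simps sum_subtractf)

lemma l2_inner_nonneg: "\<forall>a\<in>S. w a \<ge> 0 \<Longrightarrow> l2_inner S w g g \<ge> 0"
  unfolding l2_inner_def by (intro sum_nonneg) (simp add: mult.assoc)

lemma l2_inner_mapply_reversible: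
  assumes "reversible S w X"
  shows "l2_inner S w (mapply S S X g) h = l2_inner S w g (mapply S S X h)"
proof -
  have "l2_inner S w (mapply S S X g) h = (\<Sum>a\<in>S. \<Sum>b\<in>S. w a * X a b * g b * h a)"
    by (simp add: l2_inner_def mapply_def sum_distrib_left sum_distrib_right mult_ac)
  also have "\<dots> = (\<Sum>b\<in>S. \<Sum>a\<in>S. w b * X b a * g b * h a)"
    using assms unfolding reversible_def by (subst sum.swap) (intro sum.cong refl, simp)
  also have "\<dots> = l2_inner S w g (mapply S S X h)"
    by (simp add: l2_inner_def mapply_def sum_distrib_left sum_distrib_right mult_ac)
  finally show ?thesis .
qed

section \<open>Sorted eigenvalues of reversible chains\<close>

lemma diagonal_mult_mat_index:
  assumes "B \<in> carrier_mat n n" "i < n" "j < n"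
  shows "(mat n n (\<lambda>(i, j). if i = j then a i else 0) * B) $$ (i, j) = a i * B $$ (i, j)"
proof -
  have "(mat n n (\<lambda>(i, j). if i = j then a i else 0) * B) $$ (i, j)
      = (\<Sum>l<n. (if i = l then a i else 0) * B $$ (l, j))"
    using assms by (auto simp: scalar_prod_def lessThan_atLeast0 intro!: sum.cong)
  also have "\<dots> = (\<Sum>l<n. if l = i then a i * B $$ (l, j) else 0)" by (intro sum.cong) auto
  finally show ?thesis using assms(2) by simp
qed

lemma mult_diagonal_mat_index:
  assumes "B \<in> carrier_mat n n" "i < n" "j < n"
  shows "(B * mat n n (\<lambda>(i, j). if i = j then a i else 0)) $$ (i, j) = B $$ (i, j) * a j"
proof -
  have "(B * mat n n (\<lambda>(i, j). if i = j then a i else 0)) $$ (i, j)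
      = (\<Sum>l<n. B $$ (i, l) * (if l = j then a l else 0))"
    using assms by (auto simp: scalar_prod_def lessThan_atLeast0 intro!: sum.cong)
  also have "\<dots> = (\<Sum>l<n. if l = j then B $$ (i, l) * a j else 0)" by (intro sum.cong) auto
  finally show ?thesis using assms(3) by simp
qed

lemma enum_list_distinct_set: "finite S \<Longrightarrow> distinct (enum_list S) \<and> set (enum_list S) = S"
  unfolding enum_list_def by (rule someI_ex) (use finite_distinct_list in blast)

lemma length_enum_list: "finite S \<Longrightarrow> length (enum_list S) = card S"
  using enum_list_distinct_set distinct_card by metis

lemma enum_list_nth_mem: "finite S \<Longrightarrow> i < card S \<Longrightarrow> enum_list S ! i \<in> S"
  using enum_list_distinct_set length_enum_list by (metis nth_mem)

lemma bij_betw_enum_list: "finite S \<Longrightarrow> bij_betw ((!) (enum_list S)) {..<card S} S"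
  using enum_list_distinct_set length_enum_list by (metis bij_betw_nth lessThan_atLeast0)

lemma sum_enum_list: "finite S \<Longrightarrow> (\<Sum>a\<in>S. g a) = (\<Sum>i<card S. g (enum_list S ! i))"
  using sum.reindex_bij_betw[OF bij_betw_enum_list, of S g] by simp

text \<open>The matrix D^(1/2) Q D^(-1/2), D = diag w, written in the coordinates given by enum_list S:
  it is similar to Q and symmetric when Q is reversible with respect to w. The map vec_to_fun
  inverts f \<mapsto> (sqrt (w a) * f a) in these coordinates, turning quadratic forms of the matrix
  into quadratic forms of Q on L2(w).\<close>
definition symmetrized_mat :: "'a set \<Rightarrow> ('a \<Rightarrow> real) \<Rightarrow> ('a \<Rightarrow> 'a \<Rightarrow> real) \<Rightarrow> real mat" where
  "symmetrized_mat S w Q = mat (card S) (card S) (\<lambda>(i, j).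
     sqrt (w (enum_list S ! i)) * Q (enum_list S ! i) (enum_list S ! j) / sqrt (w (enum_list S ! j)))"

definition vec_to_fun :: "'a set \<Rightarrow> ('a \<Rightarrow> real) \<Rightarrow> real vec \<Rightarrow> 'a \<Rightarrow> real" where
  "vec_to_fun S w x a = x $ inv_into {..<card S} ((!) (enum_list S)) a / sqrt (w a)"

context
  fixes S :: "'a set" and w :: "'a \<Rightarrow> real"
  assumes fin: "finite S" and pos: "\<forall>a\<in>S. w a > 0"
begin

lemma symmetrized_mat_carrier: "symmetrized_mat S w Q \<in> carrier_mat (card S) (card S)"
  by (simp add: symmetrized_mat_def)

lemma symmetrized_mat_symmetric:
  assumes rev: "reversible S w Q"
  shows "transpose_mat (symmetrized_mat S w Q) = symmetrized_mat S w Q"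
proof (rule eq_matI)
  fix i j assume "i < dim_row (symmetrized_mat S w Q)" "j < dim_col (symmetrized_mat S w Q)"
  then have i: "i < card S" and j: "j < card S" by (auto simp: symmetrized_mat_def)
  define a where "a = enum_list S ! i"
  define b where "b = enum_list S ! j"
  have "a \<in> S" "b \<in> S" using enum_list_nth_mem[OF fin] i j a_def b_def by auto
  then have wpos: "w a > 0" "w b > 0" and "w a * Q a b = w b * Q b a"
    using pos rev unfolding reversible_def by auto
  from wpos have "sqrt (w b) * Q b a / sqrt (w a) = w b * Q b a / (sqrt (w a) * sqrt (w b))"
    "sqrt (w a) * Q a b / sqrt (w b) = w a * Q a b / (sqrt (w a) * sqrt (w b))"
    by (simp_all add: field_simps)
  with \<open>w a * Q a b = w b * Q b a\<close>
  have "sqrt (w b) * Q b a / sqrt (w a) = sqrt (w a) * Q a b / sqrt (w b)" by simp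
  then show "transpose_mat (symmetrized_mat S w Q) $$ (i, j) = symmetrized_mat S w Q $$ (i, j)"
    using i j by (simp add: symmetrized_mat_def a_def b_def)
qed (simp_all add: symmetrized_mat_def)

lemma char_poly_symmetrized_mat: "char_poly (symmetrized_mat S w Q) = char_poly (to_mat S Q)"
proof -
  define n where "n = card S"
  define xs where "xs = enum_list S"
  define D where "D a = mat n n (\<lambda>(i, j). if i = j then a i else (0::real))" for a :: "nat \<Rightarrow> real"
  define r where "r i = sqrt (w (xs ! i))" for i
  have r: "r i > 0" if "i < n" for i using pos enum_list_nth_mem[OF fin] that by (simp add: r_def n_def xs_def)
  have B: "symmetrized_mat S w Q \<in> carrier_mat n n" by (simp add: n_def symmetrized_mat_carrier)
  have D: "D a \<in> carrier_mat n n" for a by (simp add: D_def)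
  have DD: "(D a * D b) $$ (i, j) = (if i = j then a i * b i else 0)" if "i < n" "j < n" for a b i j
    unfolding D_def using that by (subst diagonal_mult_mat_index[of _ n]) auto
  have dimD: "dim_row (D a) = n" "dim_col (D a) = n" for a by (simp_all add: D_def)
  have D1: "D a * D b = 1\<^sub>m n" if "\<And>i. i < n \<Longrightarrow> a i * b i = 1" for a b
  proof (rule eq_matI)
    fix i j assume "i < dim_row (1\<^sub>m n)" "j < dim_col (1\<^sub>m n)"
    then show "(D a * D b) $$ (i, j) = 1\<^sub>m n $$ (i, j)" using that by (subst DD) auto
  qed (simp_all add: dimD)
  have inv: "D (\<lambda>i. 1 / r i) * D r = 1\<^sub>m n" "D r * D (\<lambda>i. 1 / r i) = 1\<^sub>m n"
    using r by (auto intro!: D1 simp: less_imp_neq[symmetric])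
  have "to_mat S Q = D (\<lambda>i. 1 / r i) * symmetrized_mat S w Q * D r"
  proof (rule eq_matI)
    fix i j assume "i < dim_row (D (\<lambda>i. 1 / r i) * symmetrized_mat S w Q * D r)"
      "j < dim_col (D (\<lambda>i. 1 / r i) * symmetrized_mat S w Q * D r)"
    then have i: "i < n" and j: "j < n" by (auto simp: D_def)
    have "(D (\<lambda>i. 1 / r i) * symmetrized_mat S w Q * D r) $$ (i, j)
        = (D (\<lambda>i. 1 / r i) * symmetrized_mat S w Q) $$ (i, j) * r j"
      unfolding D_def[of r] by (rule mult_diagonal_mat_index) (use mult_carrier_mat[OF D B] i j in auto)
    also have "\<dots> = 1 / r i * symmetrized_mat S w Q $$ (i, j) * r j"
      unfolding D_def[of "\<lambda>i. 1 / r i"] using diagonal_mult_mat_index[OF B i j] by simp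
    finally show "to_mat S Q $$ (i, j) = (D (\<lambda>i. 1 / r i) * symmetrized_mat S w Q * D r) $$ (i, j)"
      using i j r[OF i] r[OF j] length_enum_list[OF fin]
      by (simp add: to_mat_def Let_def symmetrized_mat_def r_def n_def xs_def)
  qed (auto simp: to_mat_def Let_def length_enum_list[OF fin] n_def D_def)
  moreover have "to_mat S Q \<in> carrier_mat n n"
    by (simp add: to_mat_def Let_def length_enum_list[OF fin] n_def)
  ultimately have "similar_mat_wit (to_mat S Q) (symmetrized_mat S w Q) (D (\<lambda>i. 1 / r i)) (D r)"
    unfolding similar_mat_wit_def Let_def using inv B D dimD by auto
  then show ?thesis by (metis char_poly_similar similar_mat_def)
qed

lemma vec_to_fun_enum_list:
  "i < card S \<Longrightarrow> vec_to_fun S w x (enum_list S ! i) = x $ i / sqrt (w (enum_list S ! i))"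
  using bij_betw_imp_inj_on[OF bij_betw_enum_list[OF fin]] by (simp add: vec_to_fun_def)

lemma symmetrized_mat_quadratic_form:
  assumes x: "x \<in> carrier_vec (card S)"
  shows "x \<bullet> (symmetrized_mat S w Q *\<^sub>v x)
           = l2_inner S w (vec_to_fun S w x) (mapply S S Q (vec_to_fun S w x))"
    and "x \<bullet> x = l2_inner S w (vec_to_fun S w x) (vec_to_fun S w x)"
proof -
  define f where "f = vec_to_fun S w x"
  define xs where "xs = enum_list S"
  have w: "w (xs ! i) > 0" if "i < card S" for i
    using pos enum_list_nth_mem[OF fin that] by (simp add: xs_def)
  have f: "sqrt (w (xs ! i)) * f (xs ! i) = x $ i" if "i < card S" for i
    using vec_to_fun_enum_list[OF that] w[OF that] by (simp add: f_def xs_def)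
  have "l2_inner S w f (mapply S S Q f)
      = (\<Sum>i<card S. (sqrt (w (xs ! i)) * f (xs ! i)) *
           (\<Sum>j<card S. symmetrized_mat S w Q $$ (i, j) * (sqrt (w (xs ! j)) * f (xs ! j))))"
    unfolding l2_inner_def mapply_def sum_enum_list[OF fin] xs_def[symmetric]
  proof (intro sum.cong refl)
    fix i assume "i \<in> {..<card S}"
    then have i: "i < card S" by simp
    have "(\<Sum>j<card S. symmetrized_mat S w Q $$ (i, j) * (sqrt (w (xs ! j)) * f (xs ! j)))
        = sqrt (w (xs ! i)) * (\<Sum>j<card S. Q (xs ! i) (xs ! j) * f (xs ! j))"
      unfolding sum_distrib_left using i less_imp_neq[OF w, symmetric, unfolded xs_def]
      by (intro sum.cong) (auto simp: symmetrized_mat_def xs_def)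
    moreover have "w (xs ! i) = sqrt (w (xs ! i)) * sqrt (w (xs ! i))" using w[OF i] by simp
    ultimately show "w (xs ! i) * f (xs ! i) * (if xs ! i \<in> S then \<Sum>j<card S. Q (xs ! i) (xs ! j) * f (xs ! j) else 0)
        = sqrt (w (xs ! i)) * f (xs ! i) *
          (\<Sum>j<card S. symmetrized_mat S w Q $$ (i, j) * (sqrt (w (xs ! j)) * f (xs ! j)))"
      using enum_list_nth_mem[OF fin i] by (simp add: xs_def)
  qed
  also have "\<dots> = x \<bullet> (symmetrized_mat S w Q *\<^sub>v x)"
    using x f by (auto simp: scalar_prod_sum_lessThan symmetrized_mat_def lessThan_atLeast0 scalar_prod_def
        intro!: sum.cong)
  finally show "x \<bullet> (symmetrized_mat S w Q *\<^sub>v x) = l2_inner S w f (mapply S S Q f)" by simp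
  have "l2_inner S w f f = (\<Sum>i<card S. (sqrt (w (xs ! i)) * f (xs ! i)) * (sqrt (w (xs ! i)) * f (xs ! i)))"
    unfolding l2_inner_def sum_enum_list[OF fin] xs_def[symmetric] using w
    by (intro sum.cong) (auto simp: abs_of_pos)
  also have "\<dots> = x \<bullet> x" using x f by (simp add: scalar_prod_sum_lessThan)
  finally show "x \<bullet> x = l2_inner S w f f" by simp
qed

lemma eigenvalues_desc_eigenbasis:
  assumes rev: "reversible S w Q"
  shows "\<exists>us. orthonormal_eigenbasis (card S) (symmetrized_mat S w Q) us (eigenvalues_desc S Q)"
    and "sorted_wrt (\<ge>) (eigenvalues_desc S Q)"
proof -
  obtain us ds where eb: "orthonormal_eigenbasis (card S) (symmetrized_mat S w Q) us ds"
    and srt: "sorted_wrt (\<ge>) ds"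
    using real_symmetric_sorted_eigenbasis[OF symmetrized_mat_carrier symmetrized_mat_symmetric[OF rev]]
    by blast
  have cp: "char_poly (to_mat S Q) = (\<Prod>a\<leftarrow>ds. [:- a, 1:])"
    using char_poly_orthonormal_eigenbasis[OF symmetrized_mat_carrier eb] char_poly_symmetrized_mat
    by simp
  have "eigenvalues_desc S Q = ds" unfolding eigenvalues_desc_def
    using srt cp sorted_desc_eq_of_prod_list_linear_eq[OF _ srt] by (intro the_equality) auto
  then show "\<exists>us. orthonormal_eigenbasis (card S) (symmetrized_mat S w Q) us (eigenvalues_desc S Q)"
    and "sorted_wrt (\<ge>) (eigenvalues_desc S Q)" using eb srt by auto
qed

lemma length_eigenvalues_desc:
  "reversible S w Q \<Longrightarrow> length (eigenvalues_desc S Q) = card S"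
  using eigenvalues_desc_eigenbasis(1) by (auto simp: orthonormal_eigenbasis_def)

lemma eigenvalues_desc_le_of_form_le:
  assumes rev: "reversible S w Q" and rev': "reversible S w Q'" and alpha: "\<alpha> \<ge> 0"
    and form: "\<And>f. l2_inner S w f (mapply S S Q f)
                  \<le> \<alpha> * l2_inner S w f (mapply S S Q' f) + \<beta> * l2_inner S w f f"
    and k: "k < card S"
  shows "eigenvalues_desc S Q ! k \<le> \<alpha> * eigenvalues_desc S Q' ! k + \<beta>"
proof -
  obtain us us' where
    "orthonormal_eigenbasis (card S) (symmetrized_mat S w Q) us (eigenvalues_desc S Q)"
    "orthonormal_eigenbasis (card S) (symmetrized_mat S w Q') us' (eigenvalues_desc S Q')"
    using eigenvalues_desc_eigenbasis(1) rev rev' by blast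
  then show ?thesis
    using sorted_eigenvalue_le_of_quadratic_form_le[OF symmetrized_mat_carrier symmetrized_mat_carrier _
        eigenvalues_desc_eigenbasis(2)[OF rev] _ eigenvalues_desc_eigenbasis(2)[OF rev'] _ alpha k]
      form symmetrized_mat_quadratic_form by simp
qed

lemma eigenvalues_desc_nonneg:
  assumes rev: "reversible S w Q" and form: "\<And>f. 0 \<le> l2_inner S w f (mapply S S Q f)"
    and k: "k < card S"
  shows "0 \<le> eigenvalues_desc S Q ! k"
proof -
  obtain us where eb: "orthonormal_eigenbasis (card S) (symmetrized_mat S w Q) us (eigenvalues_desc S Q)"
    using eigenvalues_desc_eigenbasis(1)[OF rev] by blast
  note u = orthonormal_eigenbasisD[OF eb k]
  have "eigenvalues_desc S Q ! k = us ! k \<bullet> (symmetrized_mat S w Q *\<^sub>v us ! k)"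
    using u(1,3) u(2)[OF k] by simp
  then show ?thesis using form symmetrized_mat_quadratic_form(1)[OF u(1)] by simp
qed


lemma spectral_gap_eq_of_form_nonneg:
  assumes rev: "reversible S w Q" and form: "\<And>f. 0 \<le> l2_inner S w f (mapply S S Q f)"
    and card: "2 \<le> card S"
  shows "spectral_gap S Q = 1 - eigenvalues_desc S Q ! 1"
proof -
  define ls where "ls = eigenvalues_desc S Q"
  have len: "length ls = card S" using length_eigenvalues_desc[OF rev] by (simp add: ls_def)
  text \<open>With a nonnegative spectrum the last eigenvalue is no larger in modulus than the second.\<close>
  have "ls ! (card S - 1) \<le> ls ! 1"
    using sorted_wrt_nth_less[OF eigenvalues_desc_eigenbasis(2)[OF rev], of 1 "card S - 1"] card len
    by (cases "card S - 1 = 1") (auto simp: ls_def)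
  moreover have "0 \<le> ls ! (card S - 1)"
    using eigenvalues_desc_nonneg[OF rev form] card by (simp add: ls_def)
  ultimately show ?thesis
    using card len by (simp add: spectral_gap_def Let_def ls_def[symmetric])
qed

lemma spectral_gap_eq_one: "reversible S w Q \<Longrightarrow> card S < 2 \<Longrightarrow> spectral_gap S Q = 1"
  using length_eigenvalues_desc by (simp add: spectral_gap_def Let_def)
end

section \<open>Commuting orthogonal projections\<close>

locale commuting_projections =
  fixes J :: "'a set" and \<nu> :: "'a \<Rightarrow> real" and A :: "nat \<Rightarrow> ('a \<Rightarrow> real) \<Rightarrow> 'a \<Rightarrow> real"
    and m :: nat
  assumes nonneg: "\<forall>a\<in>J. \<nu> a \<ge> 0"
    and diff: "\<And>i g h. i \<in> {1..m} \<Longrightarrow> A i (g - h) = A i g - A i h"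
    and self_adjoint: "\<And>i g h. i \<in> {1..m} \<Longrightarrow> l2_inner J \<nu> (A i g) h = l2_inner J \<nu> g (A i h)"
    and idem: "\<And>i g. i \<in> {1..m} \<Longrightarrow> A i (A i g) = A i g"
    and commute: "\<And>i j g. i \<in> {1..m} \<Longrightarrow> j \<in> {1..m} \<Longrightarrow> A i (A j g) = A j (A i g)"
begin

definition prod_proj :: "nat \<Rightarrow> ('a \<Rightarrow> real) \<Rightarrow> 'a \<Rightarrow> real" where
  "prod_proj k g = foldr A [1..<k+1] g"

lemma prod_proj_0 [simp]: "prod_proj 0 g = g"
  by (simp add: prod_proj_def)

lemma prod_proj_Suc: "prod_proj (Suc k) g = prod_proj k (A (Suc k) g)"
  by (simp add: prod_proj_def)

lemma prod_proj_diff: "k \<le> m \<Longrightarrow> prod_proj k (g - h) = prod_proj k g - prod_proj k h"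
  by (induction k arbitrary: g h) (simp_all add: prod_proj_Suc diff)

lemma prod_proj_commute: "j \<in> {1..m} \<Longrightarrow> k \<le> m \<Longrightarrow> prod_proj k (A j g) = A j (prod_proj k g)"
  by (induction k arbitrary: g) (simp_all add: prod_proj_Suc commute)

lemma prod_proj_self_adjoint:
  "k \<le> m \<Longrightarrow> l2_inner J \<nu> (prod_proj k g) h = l2_inner J \<nu> g (prod_proj k h)"
proof (induction k arbitrary: g h)
  case (Suc k)
  have "l2_inner J \<nu> (prod_proj (Suc k) g) h = l2_inner J \<nu> (A (Suc k) g) (prod_proj k h)"
    using Suc by (simp add: prod_proj_Suc)
  also have "\<dots> = l2_inner J \<nu> g (prod_proj (Suc k) h)"
    using Suc.prems by (simp add: self_adjoint prod_proj_commute prod_proj_Suc)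
  finally show ?case .
qed simp

lemma prod_proj_absorb: "i \<in> {1..k} \<Longrightarrow> k \<le> m \<Longrightarrow> prod_proj k (A i g) = prod_proj k g"
proof (induction k arbitrary: g)
  case (Suc k)
  show ?case
  proof (cases "i = Suc k")
    case False
    then have "i \<in> {1..k}" using Suc.prems by auto
    then show ?thesis using Suc commute[of "Suc k" i g] by (simp add: prod_proj_Suc)
  qed (use Suc.prems idem in \<open>simp add: prod_proj_Suc\<close>)
qed simp

lemma prod_proj_idem: "k \<le> m \<Longrightarrow> prod_proj k (prod_proj k g) = prod_proj k g"
proof -
  assume k: "k \<le> m"
  have "prod_proj k (prod_proj j g) = prod_proj k g" if "j \<le> k" for j
    using that by (induction j arbitrary: g) (simp_all add: prod_proj_Suc prod_proj_absorb k)
  then show ?thesis by simp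
qed

lemma proj_form_eq_norm: "i \<in> {1..m} \<Longrightarrow> l2_inner J \<nu> (A i g) g = l2_inner J \<nu> (A i g) (A i g)"
  using self_adjoint[of i "A i g" g] idem[of i g] by (simp add: l2_inner_commute)

lemma proj_pythagoras:
  "i \<in> {1..m} \<Longrightarrow> l2_inner J \<nu> g g
     = l2_inner J \<nu> (A i g) (A i g) + l2_inner J \<nu> (g - A i g) (g - A i g)"
  using proj_form_eq_norm[of i g] by (simp add: l2_inner_diff_left l2_inner_diff_right l2_inner_commute)

lemma proj_norm_le: "i \<in> {1..m} \<Longrightarrow> l2_inner J \<nu> (A i g) (A i g) \<le> l2_inner J \<nu> g g"
  using proj_pythagoras[of i g] l2_inner_nonneg[OF nonneg, of "g - A i g"] by linarith

lemma proj_form_bounds: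
  "i \<in> {1..m} \<Longrightarrow> 0 \<le> l2_inner J \<nu> (A i g) g \<and> l2_inner J \<nu> (A i g) g \<le> l2_inner J \<nu> g g"
  using proj_form_eq_norm proj_norm_le l2_inner_nonneg[OF nonneg, of "A i g"] by simp

lemma prod_proj_norm_le: "k \<le> m \<Longrightarrow> l2_inner J \<nu> (prod_proj k g) (prod_proj k g) \<le> l2_inner J \<nu> g g"
proof (induction k arbitrary: g)
  case (Suc k)
  then have "l2_inner J \<nu> (prod_proj (Suc k) g) (prod_proj (Suc k) g)
      \<le> l2_inner J \<nu> (A (Suc k) g) (A (Suc k) g)" by (simp add: prod_proj_Suc)
  also have "\<dots> \<le> l2_inner J \<nu> g g" using Suc.prems by (intro proj_norm_le) simp
  finally show ?case .
qed simp

lemma prod_proj_form_eq_norm: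
  "k \<le> m \<Longrightarrow> l2_inner J \<nu> (prod_proj k g) g = l2_inner J \<nu> (prod_proj k g) (prod_proj k g)"
  using prod_proj_self_adjoint[of k "prod_proj k g" g] prod_proj_idem[of k g] by simp

lemma prod_proj_form_le_proj_form:
  assumes i: "i \<in> {1..m}"
  shows "l2_inner J \<nu> (prod_proj m g) g \<le> l2_inner J \<nu> (A i g) g"
proof -
  text \<open>The product of all projections factors through A i.\<close>
  have "l2_inner J \<nu> (prod_proj m g) g = l2_inner J \<nu> (A i g) (prod_proj m g)"
    using prod_proj_absorb[OF i] prod_proj_self_adjoint[of m "A i g" g] by simp
  also have "\<dots> = l2_inner J \<nu> (prod_proj m (A i g)) (A i g)"
    using prod_proj_absorb[OF i order_refl] l2_inner_commute by metis
  also have "\<dots> \<le> l2_inner J \<nu> (A i g) (A i g)"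
    using prod_proj_form_eq_norm[of m "A i g"] prod_proj_norm_le[of m "A i g"] by simp
  also have "\<dots> = l2_inner J \<nu> (A i g) g" using proj_form_eq_norm[OF i] by simp
  finally show ?thesis .
qed

lemma norm_minus_prod_proj_form_le_sum:
  "k \<le> m \<Longrightarrow> l2_inner J \<nu> g g - l2_inner J \<nu> (prod_proj k g) g
     \<le> (\<Sum>i=1..k. l2_inner J \<nu> g g - l2_inner J \<nu> (A i g) g)"
proof (induction k)
  case (Suc k)
  let ?T = "A (Suc k)" and ?ip = "l2_inner J \<nu>"
  have i: "Suc k \<in> {1..m}" and k: "k \<le> m" using Suc.prems by auto
  text \<open>prod_proj k maps the ranges of ?T and of its complement to orthogonal functions.\<close>
  have "?ip (prod_proj k (?T g)) (prod_proj k (g - ?T g)) = ?ip (?T (prod_proj k g)) (g - ?T g)"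
    using prod_proj_self_adjoint[OF k] prod_proj_idem[OF k] prod_proj_commute[OF i k] by metis
  also have "\<dots> = ?ip (prod_proj k g) (?T g - ?T (?T g))"
    using self_adjoint[OF i] diff[OF i] by simp
  also have "\<dots> = 0" using idem[OF i] by (simp add: l2_inner_def)
  finally have orth: "?ip (prod_proj k (?T g)) (prod_proj k (g - ?T g)) = 0" .
  have "?ip (prod_proj k g) (prod_proj k g)
      = ?ip (prod_proj k (?T g)) (prod_proj k (?T g)) + ?ip (prod_proj k (g - ?T g)) (prod_proj k (g - ?T g))"
    using orth prod_proj_diff[OF k, of g "?T g"]
    by (simp add: l2_inner_diff_left l2_inner_diff_right l2_inner_commute)
  moreover have "?ip (prod_proj k (g - ?T g)) (prod_proj k (g - ?T g)) \<le> ?ip (g - ?T g) (g - ?T g)"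
    by (rule prod_proj_norm_le[OF k])
  moreover have "?ip (g - ?T g) (g - ?T g) = ?ip g g - ?ip (?T g) g"
    using proj_pythagoras[OF i, of g] proj_form_eq_norm[OF i, of g] by simp
  moreover have "?ip (prod_proj (Suc k) g) g = ?ip (prod_proj k (?T g)) (prod_proj k (?T g))"
    using prod_proj_form_eq_norm[OF Suc.prems, of g] by (simp add: prod_proj_Suc)
  ultimately show ?case using Suc.IH[OF k] prod_proj_form_eq_norm[OF k, of g] by simp
qed simp

end

section \<open>Lifting through a stochastic matrix and its adjoint\<close>

lemma square_weighted_sum_le:
  fixes a y :: "'a \<Rightarrow> real"
  assumes "finite I" "\<And>i. i \<in> I \<Longrightarrow> a i \<ge> 0" "(\<Sum>i\<in>I. a i) = 1"
  shows "(\<Sum>i\<in>I. a i * y i)\<^sup>2 \<le> (\<Sum>i\<in>I. a i * (y i)\<^sup>2)"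
proof -
  define c where "c = (\<Sum>i\<in>I. a i * y i)"
  have "0 \<le> (\<Sum>i\<in>I. a i * (y i - c)\<^sup>2)" using assms(2) by (intro sum_nonneg) simp
  also have "\<dots> = (\<Sum>i\<in>I. a i * (y i)\<^sup>2) - 2 * c * (\<Sum>i\<in>I. a i * y i) + c\<^sup>2 * (\<Sum>i\<in>I. a i)"
    by (simp add: power2_eq_square algebra_simps sum.distrib sum_subtractf sum_distrib_left)
  finally show ?thesis using assms(3) by (simp add: c_def power2_eq_square)
qed

context
  fixes S :: "'a set" and J :: "'b set" and \<mu> :: "'a \<Rightarrow> real" and M :: "'a \<Rightarrow> 'b \<Rightarrow> real"
  assumes finS: "finite S" and finJ: "finite J" and mu_pos: "\<forall>a\<in>S. \<mu> a > 0"
    and M: "stochastic S J M" and nu_pos: "\<forall>x\<in>J. push_measure S \<mu> M x > 0"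
begin

lemma push_measure_nonzero: "x \<in> J \<Longrightarrow> push_measure S \<mu> M x \<noteq> 0"
  using nu_pos by force

lemma l2_inner_mapply_adjoint:
  "l2_inner S \<mu> f (mapply S J M h)
     = l2_inner J (push_measure S \<mu> M) (mapply J S (adjoint S \<mu> M) f) h"
proof -
  have "l2_inner S \<mu> f (mapply S J M h) = (\<Sum>x\<in>J. \<Sum>a\<in>S. \<mu> a * M a x * f a * h x)"
    by (simp add: l2_inner_def mapply_def sum_distrib_left mult_ac sum.swap[of _ J])
  also have "\<dots> = l2_inner J (push_measure S \<mu> M) (mapply J S (adjoint S \<mu> M) f) h"
    unfolding l2_inner_def mapply_def adjoint_def using push_measure_nonzero
    by (intro sum.cong refl) (simp add: sum_distrib_left sum_distrib_right mult_ac)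
  finally show ?thesis .
qed

lemma norm_mapply_adjoint_le:
  "l2_inner J (push_measure S \<mu> M) (mapply J S (adjoint S \<mu> M) f) (mapply J S (adjoint S \<mu> M) f)
     \<le> l2_inner S \<mu> f f"
proof -
  let ?\<nu> = "push_measure S \<mu> M" and ?M' = "adjoint S \<mu> M"
  text \<open>Each row of the adjoint is a probability vector, so Jensen's inequality applies row by row.\<close>
  have row: "(\<Sum>b\<in>S. ?M' x b * f b)\<^sup>2 \<le> (\<Sum>b\<in>S. ?M' x b * (f b)\<^sup>2)" if x: "x \<in> J" for x
  proof (rule square_weighted_sum_le[OF finS])
    show "?M' x b \<ge> 0" if "b \<in> S" for b
      using M mu_pos nu_pos x that by (auto simp: adjoint_def stochastic_def less_imp_le)
    have "(\<Sum>b\<in>S. ?M' x b) = (\<Sum>b\<in>S. \<mu> b * M b x) / ?\<nu> x"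
      by (simp add: adjoint_def sum_divide_distrib)
    then show "(\<Sum>b\<in>S. ?M' x b) = 1"
      using push_measure_nonzero[OF x] by (simp add: push_measure_def)
  qed
  have "l2_inner J ?\<nu> (mapply J S ?M' f) (mapply J S ?M' f) \<le> (\<Sum>x\<in>J. ?\<nu> x * (\<Sum>b\<in>S. ?M' x b * (f b)\<^sup>2))"
    unfolding l2_inner_def mapply_def using row nu_pos
    by (intro sum_mono) (simp add: mult.assoc mult_left_mono power2_eq_square less_imp_le)
  also have "\<dots> = (\<Sum>x\<in>J. \<Sum>b\<in>S. \<mu> b * (f b)\<^sup>2 * M b x)"
    using push_measure_nonzero by (intro sum.cong refl) (simp add: adjoint_def sum_distrib_left mult_ac)
  also have "\<dots> = (\<Sum>b\<in>S. \<mu> b * (f b)\<^sup>2 * (\<Sum>x\<in>J. M b x))"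
    by (simp add: sum.swap[of _ J] sum_distrib_left)
  also have "\<dots> = l2_inner S \<mu> f f"
    using M by (simp add: stochastic_def l2_inner_def power2_eq_square mult_ac)
  finally show ?thesis .
qed

lemma reversible_mmult_adjoint:
  assumes X: "reversible J (push_measure S \<mu> M) X"
  shows "reversible S \<mu> (mmult J (mmult J M X) (adjoint S \<mu> M))"
proof -
  let ?\<nu> = "push_measure S \<mu> M"
  have X': "X x y / ?\<nu> y = X y x / ?\<nu> x" if "x \<in> J" "y \<in> J" for x y
    using X nu_pos that unfolding reversible_def by (simp add: field_simps less_imp_neq[symmetric])
  define F where "F c d = (\<Sum>y\<in>J. \<Sum>x\<in>J. \<mu> c * M c x * (\<mu> d * M d y) * (X x y / ?\<nu> y))" for c d
  have F: "\<mu> c * mmult J (mmult J M X) (adjoint S \<mu> M) c d = F c d" for c d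
    by (simp add: F_def mmult_def adjoint_def sum_distrib_left sum_distrib_right sum_divide_distrib mult_ac)
  have "F a b = F b a" for a b
    unfolding F_def by (subst sum.swap) (auto intro!: sum.cong simp: X' mult_ac)
  then show ?thesis unfolding reversible_def F by blast
qed

lemma form_mmult_adjoint:
  "l2_inner S \<mu> f (mapply S S (mmult J (mmult J M X) (adjoint S \<mu> M)) f)
     = l2_inner J (push_measure S \<mu> M) (mapply J S (adjoint S \<mu> M) f)
         (mapply J J X (mapply J S (adjoint S \<mu> M) f))"
  unfolding mapply_mmult l2_inner_mapply_adjoint ..

end

section \<open>Comparison of the spectral gaps\<close>

locale lifted_projections =
  fixes S :: "'a set" and J :: "'b set" and \<mu> :: "'a \<Rightarrow> real" and M :: "'a \<Rightarrow> 'b \<Rightarrow> real"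
    and T :: "nat \<Rightarrow> 'b \<Rightarrow> 'b \<Rightarrow> real" and m :: nat
  assumes finite_S: "finite S" and finite_J: "finite J" and mu_pos: "\<forall>a\<in>S. \<mu> a > 0"
    and M_stochastic: "stochastic S J M"
    and nu_pos: "\<forall>x\<in>J. push_measure S \<mu> M x > 0"
    and m_pos: "m > 0"
    and T_reversible: "\<forall>i\<in>{1..m}. reversible J (push_measure S \<mu> M) (T i)"
    and T_idem: "\<forall>i\<in>{1..m}. \<forall>x\<in>J. \<forall>y\<in>J. mmult J (T i) (T i) x y = T i x y"
    and T_comm: "\<forall>i\<in>{1..m}. \<forall>j\<in>{1..m}. \<forall>x\<in>J. \<forall>y\<in>J.
                   mmult J (T i) (T j) x y = mmult J (T j) (T i) x y"
begin

abbreviation \<nu> :: "'b \<Rightarrow> real" where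
  "\<nu> \<equiv> push_measure S \<mu> M"

definition lift :: "('a \<Rightarrow> real) \<Rightarrow> 'b \<Rightarrow> real" where
  "lift f = mapply J S (adjoint S \<mu> M) f"

definition P_prod :: "'a \<Rightarrow> 'a \<Rightarrow> real" where
  "P_prod = mmult J (mmult J M (mprod_list J (map T [1..<m+1]))) (adjoint S \<mu> M)"

definition P_avg :: "'a \<Rightarrow> 'a \<Rightarrow> real" where
  "P_avg = mmult J (mmult J M (\<lambda>x y. 1 / real m * (\<Sum>i=1..m. T i x y))) (adjoint S \<mu> M)"

sublocale proj: commuting_projections J \<nu> "\<lambda>i. mapply J J (T i)" m
proof
  show "\<forall>a\<in>J. \<nu> a \<ge> 0" using nu_pos by (simp add: less_imp_le)
next
  fix i g h
  show "mapply J J (T i) (g - h) = mapply J J (T i) g - mapply J J (T i) h" by (rule mapply_diff)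
next
  fix i g h assume "i \<in> {1..m}"
  then show "l2_inner J \<nu> (mapply J J (T i) g) h = l2_inner J \<nu> g (mapply J J (T i) h)"
    using T_reversible l2_inner_mapply_reversible by blast
next
  fix i g assume i: "i \<in> {1..m}"
  have "mapply J J (mmult J (T i) (T i)) = mapply J J (T i)"
    using T_idem i by (intro mapply_cong) auto
  then show "mapply J J (T i) (mapply J J (T i) g) = mapply J J (T i) g"
    by (metis mapply_mmult)
next
  fix i j g assume "i \<in> {1..m}" "j \<in> {1..m}"
  then have "mapply J J (mmult J (T i) (T j)) = mapply J J (mmult J (T j) (T i))"
    using T_comm by (intro mapply_cong) auto
  then show "mapply J J (T i) (mapply J J (T j) g) = mapply J J (T j) (mapply J J (T i) g)"
    by (metis mapply_mmult)
qed

lemma lift_vanishes: "x \<notin> J \<Longrightarrow> lift f x = 0"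
  by (simp add: lift_def mapply_def)

lemma form_P_prod:
  "l2_inner S \<mu> f (mapply S S P_prod f) = l2_inner J \<nu> (proj.prod_proj m (lift f)) (lift f)"
proof -
  have "mapply J J (mprod_list J (map T [1..<m+1])) (lift f) = proj.prod_proj m (lift f)"
    using mapply_mid[OF finite_J lift_vanishes]
    by (simp add: mapply_mprod_list proj.prod_proj_def foldr_map comp_def)
  then show ?thesis
    unfolding P_prod_def form_mmult_adjoint[OF finite_S finite_J mu_pos M_stochastic nu_pos]
    by (simp add: lift_def l2_inner_commute)
qed

lemma form_P_avg:
  "l2_inner S \<mu> f (mapply S S P_avg f) = (\<Sum>i=1..m. l2_inner J \<nu> (mapply J J (T i) (lift f)) (lift f)) / m"
proof -
  have avg: "mapply J J (\<lambda>x y. 1 / real m * (\<Sum>i=1..m. T i x y)) g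
      = (\<lambda>a. (\<Sum>i=1..m. mapply J J (T i) g a) / m)" for g
    unfolding mapply_def fun_eq_iff
    by (simp add: sum_distrib_left sum_distrib_right sum_divide_distrib sum.swap[of _ J] mult_ac)
  have "l2_inner J \<nu> g (\<lambda>a. (\<Sum>i=1..m. h i a) / m) = (\<Sum>i=1..m. l2_inner J \<nu> (h i) g) / m" for g h
    by (simp add: l2_inner_def sum_distrib_left sum_divide_distrib sum.swap[of _ J] mult_ac)
  then show ?thesis
    unfolding P_avg_def form_mmult_adjoint[OF finite_S finite_J mu_pos M_stochastic nu_pos] avg
    by (simp add: lift_def)
qed

lemma norm_lift_le: "l2_inner J \<nu> (lift f) (lift f) \<le> l2_inner S \<mu> f f"
  unfolding lift_def by (rule norm_mapply_adjoint_le[OF finite_S finite_J mu_pos M_stochastic nu_pos])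

lemma reversible_P_avg: "reversible S \<mu> P_avg"
proof -
  have "reversible J \<nu> (\<lambda>x y. 1 / real m * (\<Sum>i=1..m. T i x y))"
    using T_reversible by (simp add: reversible_def sum_distrib_left mult_ac)
  then show ?thesis unfolding P_avg_def
    by (rule reversible_mmult_adjoint[OF finite_S finite_J mu_pos M_stochastic nu_pos])
qed

lemma form_P_prod_le_form_P_avg:
  "l2_inner S \<mu> f (mapply S S P_prod f) \<le> l2_inner S \<mu> f (mapply S S P_avg f)"
proof -
  have "(\<Sum>i=1..m. l2_inner J \<nu> (proj.prod_proj m (lift f)) (lift f))
      \<le> (\<Sum>i=1..m. l2_inner J \<nu> (mapply J J (T i) (lift f)) (lift f))"
    by (rule sum_mono, rule proj.prod_proj_form_le_proj_form)
  then show ?thesis using m_pos by (simp add: form_P_prod form_P_avg le_divide_eq mult.commute)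
qed

lemma form_P_avg_le:
  "l2_inner S \<mu> f (mapply S S P_avg f)
     \<le> 1 / m * l2_inner S \<mu> f (mapply S S P_prod f) + (1 - 1 / m) * l2_inner S \<mu> f f"
proof -
  let ?g = "lift f" and ?ip = "l2_inner J \<nu>"
  have "?ip ?g ?g - ?ip (proj.prod_proj m ?g) ?g \<le> (\<Sum>i=1..m. ?ip ?g ?g - ?ip (mapply J J (T i) ?g) ?g)"
    by (rule proj.norm_minus_prod_proj_form_le_sum) simp
  then have "(\<Sum>i=1..m. ?ip (mapply J J (T i) ?g) ?g) \<le> (real m - 1) * ?ip ?g ?g + ?ip (proj.prod_proj m ?g) ?g"
    by (simp add: sum_subtractf algebra_simps)
  also have "\<dots> \<le> (real m - 1) * l2_inner S \<mu> f f + ?ip (proj.prod_proj m ?g) ?g"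
    using norm_lift_le[of f] m_pos by (intro add_right_mono mult_left_mono) auto
  finally have "(\<Sum>i=1..m. ?ip (mapply J J (T i) ?g) ?g) / m
      \<le> ((real m - 1) * l2_inner S \<mu> f f + ?ip (proj.prod_proj m ?g) ?g) / m"
    using m_pos by (intro divide_right_mono) auto
  moreover have "(real m - 1) * l2_inner S \<mu> f f / m = (1 - 1 / m) * l2_inner S \<mu> f f"
    using m_pos by (simp add: field_simps)
  ultimately show ?thesis by (simp add: form_P_prod form_P_avg add_divide_distrib)
qed

lemma form_P_prod_nonneg: "0 \<le> l2_inner S \<mu> f (mapply S S P_prod f)"
  using proj.prod_proj_form_eq_norm[of m] l2_inner_nonneg[OF proj.nonneg] by (simp add: form_P_prod)

lemma form_P_avg_nonneg: "0 \<le> l2_inner S \<mu> f (mapply S S P_avg f)"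
proof -
  have "0 \<le> (\<Sum>i=1..m. l2_inner J \<nu> (mapply J J (T i) (lift f)) (lift f))"
    by (rule sum_nonneg) (use proj.proj_form_bounds in blast)
  then show ?thesis by (simp add: form_P_avg)
qed

lemma form_P_avg_le_norm: "l2_inner S \<mu> f (mapply S S P_avg f) \<le> l2_inner S \<mu> f f"
proof -
  have "(\<Sum>i=1..m. l2_inner J \<nu> (mapply J J (T i) (lift f)) (lift f))
      \<le> (\<Sum>i=1..m. l2_inner J \<nu> (lift f) (lift f))"
    by (rule sum_mono) (use proj.proj_form_bounds in blast)
  also have "\<dots> \<le> m * l2_inner S \<mu> f f" using norm_lift_le[of f] by (simp add: mult_left_mono)
  finally show ?thesis using m_pos by (simp add: form_P_avg divide_simps mult.commute)
qed

theorem spectral_gap_P_avg_le: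
  assumes P_rev: "reversible S \<mu> P" and P_eq: "\<forall>a\<in>S. \<forall>b\<in>S. P a b = P_prod a b"
  shows "0 \<le> spectral_gap S P_avg \<and> spectral_gap S P_avg \<le> spectral_gap S P \<and>
    spectral_gap S P \<le> m * spectral_gap S P_avg"
proof (cases "2 \<le> card S")
  case True
  then have k: "1 < card S" by simp
  define eP eL where "eP = eigenvalues_desc S P" and "eL = eigenvalues_desc S P_avg"
  note compare = eigenvalues_desc_le_of_form_le[OF finite_S mu_pos _ _ _ _ k]
  have "mapply S S P = mapply S S P_prod" using P_eq by (intro mapply_cong) auto
  then have form_P: "l2_inner S \<mu> f (mapply S S P f) = l2_inner S \<mu> f (mapply S S P_prod f)" for f
    by simp
  have P_le: "eP ! 1 \<le> 1 * eL ! 1 + 0"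
    unfolding eP_def eL_def
    by (rule compare[OF P_rev reversible_P_avg]) (simp_all add: form_P form_P_prod_le_form_P_avg)
  have L_le: "eL ! 1 \<le> 1 / m * eP ! 1 + (1 - 1 / m)"
    unfolding eP_def eL_def
    by (rule compare[OF reversible_P_avg P_rev]) (simp, simp only: form_P form_P_avg_le)
  have L_le_1: "eL ! 1 \<le> 0 * eL ! 1 + 1"
    unfolding eL_def
    by (rule compare[OF reversible_P_avg reversible_P_avg]) (simp_all add: form_P_avg_le_norm)
  have "m * eL ! 1 \<le> m * (1 / m * eP ! 1 + (1 - 1 / m))"
    using L_le by (rule mult_left_mono) simp
  also have "\<dots> = eP ! 1 + (real m - 1)"
    using m_pos by (simp add: field_simps)
  finally show ?thesis
    using P_le L_le_1 True form_P form_P_prod_nonneg form_P_avg_nonneg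
      spectral_gap_eq_of_form_nonneg[OF finite_S mu_pos P_rev]
      spectral_gap_eq_of_form_nonneg[OF finite_S mu_pos reversible_P_avg]
    by (simp add: eP_def eL_def right_diff_distrib)
next
  case False
  then show ?thesis
    using spectral_gap_eq_one[OF finite_S mu_pos] P_rev reversible_P_avg m_pos by simp
qed
end

section \<open>The random-cluster setting\<close>

lemma finite_graph_finite_edges: "finite_graph V E \<Longrightarrow> finite E"
proof -
  assume "finite_graph V E"
  then have "finite V" "E \<subseteq> Pow V" by (auto simp: finite_graph_def)
  then show "finite E" by (meson finite_Pow_iff finite_subset)
qed

lemma rc_measure_pos:
  assumes "finite E" "0 < p" "p < 1" "0 < q"
  shows "0 < rc_measure V E p q A"
proof -
  have "0 < rc_weight V E p q B" for B using assms by (simp add: rc_weight_def)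
  moreover from this have "0 < (\<Sum>B\<in>Pow E. rc_weight V E p q B)" using assms(1) by (intro sum_pos) auto
  ultimately show ?thesis by (simp add: rc_measure_def)
qed

lemma push_measure_pos_of_adjoint_stochastic:
  assumes "finite S" "\<forall>a\<in>S. \<mu> a > 0" "stochastic S J M" "stochastic J S (adjoint S \<mu> M)"
  shows "\<forall>x\<in>J. push_measure S \<mu> M x > 0"
proof
  fix x assume x: "x \<in> J"
  have "0 \<le> push_measure S \<mu> M x"
    using assms(2,3) x by (auto simp: push_measure_def stochastic_def intro!: sum_nonneg)
  moreover have "push_measure S \<mu> M x \<noteq> 0"
  proof
    text \<open>Division by zero would make the corresponding row of the adjoint vanish.\<close>
    assume "push_measure S \<mu> M x = 0"
    then have "(\<Sum>B\<in>S. adjoint S \<mu> M x B) = 0" by (simp add: adjoint_def)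
    then show False using assms(4) x by (simp add: stochastic_def)
  qed
  ultimately show "push_measure S \<mu> M x > 0" by simp
qed

lemma le_eight_mult_ln: "2 \<le> m \<Longrightarrow> real m \<le> 8 * real m * ln (real m)"
proof -
  assume m: "2 \<le> m"
  have "1 / 2 \<le> ln (2::real)" using ln_add1_ge[of "1::real"] by simp
  also have "\<dots> \<le> ln (real m)" using m by simp
  finally show ?thesis using m by (simp add: field_simps)
qed

theorem mainTheorem4:
  fixes V :: "'v set" and E :: "'v set set" and p q :: real and r m :: nat
    and P :: "'v set set \<Rightarrow> 'v set set \<Rightarrow> real"
    and M :: "'v set set \<Rightarrow> ('v \<Rightarrow> nat) \<times> 'v set set \<Rightarrow> real"
    and T :: "nat \<Rightarrow> ('v \<Rightarrow> nat) \<times> 'v set set \<Rightarrow> ('v \<Rightarrow> nat) \<times> 'v set set \<Rightarrow> real"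
  assumes graph: "finite_graph V E"
    and p: "0 < p" "p < 1" and q: "0 < q"
    and m: "m \<ge> 2"
    and P_ergodic: "ergodic_chain (Pow E) P"
    and P_rev: "reversible (Pow E) (rc_measure V E p q) P"
    and M_stoch: "stochastic (Pow E) ((V \<rightarrow>\<^sub>E {..<r}) \<times> Pow E) M"
    and M_supp: "\<forall>A\<in>Pow E. \<forall>\<sigma> B. (\<sigma>, B) \<in> (V \<rightarrow>\<^sub>E {..<r}) \<times> Pow E \<longrightarrow>
                   M A (\<sigma>, B) \<noteq> 0 \<longrightarrow> A = B"
    and T_stoch: "\<forall>i\<in>{1..m}. stochastic ((V \<rightarrow>\<^sub>E {..<r}) \<times> Pow E) ((V \<rightarrow>\<^sub>E {..<r}) \<times> Pow E) (T i)"
    and T_rev: "\<forall>i\<in>{1..m}. reversible ((V \<rightarrow>\<^sub>E {..<r}) \<times> Pow E)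
                   (push_measure (Pow E) (rc_measure V E p q) M) (T i)"
    and T_supp: "\<forall>i\<in>{1..m}. \<forall>\<sigma> A \<tau> B. (\<sigma>, A) \<in> (V \<rightarrow>\<^sub>E {..<r}) \<times> Pow E \<longrightarrow>
                   (\<tau>, B) \<in> (V \<rightarrow>\<^sub>E {..<r}) \<times> Pow E \<longrightarrow>
                   T i (\<sigma>, A) (\<tau>, B) \<noteq> 0 \<longrightarrow> \<sigma> = \<tau>"
    and Mstar_stoch: "stochastic ((V \<rightarrow>\<^sub>E {..<r}) \<times> Pow E) (Pow E)
                        (adjoint (Pow E) (rc_measure V E p q) M)"
    and P_eq: "\<forall>A\<in>Pow E. \<forall>B\<in>Pow E.
       P A B = mmult ((V \<rightarrow>\<^sub>E {..<r}) \<times> Pow E)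
                 (mmult ((V \<rightarrow>\<^sub>E {..<r}) \<times> Pow E) M
                    (mprod_list ((V \<rightarrow>\<^sub>E {..<r}) \<times> Pow E) (map T [1..<m+1])))
                 (adjoint (Pow E) (rc_measure V E p q) M) A B"
    and T_idem: "\<forall>i\<in>{1..m}. \<forall>x\<in>(V \<rightarrow>\<^sub>E {..<r}) \<times> Pow E. \<forall>y\<in>(V \<rightarrow>\<^sub>E {..<r}) \<times> Pow E.
                   mmult ((V \<rightarrow>\<^sub>E {..<r}) \<times> Pow E) (T i) (T i) x y = T i x y"
    and T_comm: "\<forall>i\<in>{1..m}. \<forall>j\<in>{1..m}. \<forall>x\<in>(V \<rightarrow>\<^sub>E {..<r}) \<times> Pow E. \<forall>y\<in>(V \<rightarrow>\<^sub>E {..<r}) \<times> Pow E.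
                   mmult ((V \<rightarrow>\<^sub>E {..<r}) \<times> Pow E) (T i) (T j) x y
                 = mmult ((V \<rightarrow>\<^sub>E {..<r}) \<times> Pow E) (T j) (T i) x y"
  shows "spectral_gap (Pow E)
            (mmult ((V \<rightarrow>\<^sub>E {..<r}) \<times> Pow E)
               (mmult ((V \<rightarrow>\<^sub>E {..<r}) \<times> Pow E) M
                  (\<lambda>x y. (1 / real m) * (\<Sum>i=1..m. T i x y)))
               (adjoint (Pow E) (rc_measure V E p q) M))
         \<le> spectral_gap (Pow E) P
       \<and> spectral_gap (Pow E) P
         \<le> 8 * real m * ln (real m) *
           spectral_gap (Pow E)
            (mmult ((V \<rightarrow>\<^sub>E {..<r}) \<times> Pow E)
               (mmult ((V \<rightarrow>\<^sub>E {..<r}) \<times> Pow E) M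
                  (\<lambda>x y. (1 / real m) * (\<Sum>i=1..m. T i x y)))
               (adjoint (Pow E) (rc_measure V E p q) M))"
proof -
  let ?J = "(V \<rightarrow>\<^sub>E {..<r}) \<times> Pow E" and ?\<mu> = "rc_measure V E p q"
  have finE: "finite E" using graph by (rule finite_graph_finite_edges)
  have "finite V" using graph by (simp add: finite_graph_def)
  have mu: "\<forall>A\<in>Pow E. ?\<mu> A > 0" using rc_measure_pos[OF finE p q] by simp
  interpret lifted_projections "Pow E" ?J ?\<mu> M T m
  proof
    show "finite ?J" using \<open>finite V\<close> finE by (intro finite_cartesian_product finite_PiE) auto
    show "\<forall>x\<in>?J. push_measure (Pow E) ?\<mu> M x > 0"
      using push_measure_pos_of_adjoint_stochastic[OF _ mu M_stoch Mstar_stoch] finE by simp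
  qed (use finE mu M_stoch m T_rev T_idem T_comm in auto)
  have "0 \<le> spectral_gap (Pow E) P_avg \<and> spectral_gap (Pow E) P_avg \<le> spectral_gap (Pow E) P \<and>
      spectral_gap (Pow E) P \<le> m * spectral_gap (Pow E) P_avg"
    using spectral_gap_P_avg_le[OF P_rev] P_eq by (simp add: P_prod_def)
  moreover have "real m \<le> 8 * real m * ln (real m)" using m by (rule le_eight_mult_ln)
  ultimately show ?thesis unfolding P_avg_def by (meson mult_right_mono order_trans)
qed

end
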